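(* Every reduced spherical convex body $R\subset S^2$ of thickness $\Delta(R)\le\frac{\pi}{2}$ is contained in a disk of radius $$\rho=\arctan\left(\sqrt{2}\cdot\tan\frac{\Delta(R)}{2}\right).$$
   Context: $S^2$ is the unit sphere in $E^3$ with spherical (geodesic) distance. For non-antipodal $a,b$, the arc $ab$ is the shorter part of the great circle through $a,b$. A set $C\subset S^2$ is convex if it contains no pair of antipodes and $ab\subset C$ for all $a,b\in C$. A convex body is a closed convex set with non-empty interior. A disk of radius $\rho$ is the set of points at distance at most $\rho$ from a point (its center). A hemisphere is a disk of radius $\frac{\pi}{2}$. A hemisphere $K$ supports $C$ if $C\subset K$ and $\mathrm{bd}(C)\cap\mathrm{bd}(K)\neq\emptyset$. If hemispheres $G,H$ are different and not opposite (centers not antipodal), $L=G\cap H$ is a lune, bounded by the semicircles $\mathrm{bd}(G)\cap H$ and $\mathrm{bd}(H)\cap G$. Its thickness $\Delta(L)$ is the spherical distance between the centers (midpoints) of these semicircles. For a hemisphere $K$ supporting $C$, $\mathrm{width}_K(C)$ is the minimum of $\Delta(K\cap K')$ over all hemispheres $K'$ supporting $C$ for which $K\cap K'$ is a lune. The thickness $\Delta(C)$ is the minimum of $\mathrm{width}_K(C)$ over all hemispheres $K$ supporting $C$. A convex body $R$ is reduced if $\Delta(Z)<\Delta(R)$ for every convex body $Z\subset R$ with $Z\neq R$. *)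

theory Defs
  imports "HOL-Analysis.Analysis"
begin

definition S2 :: "(real^3) set" where
  "S2 = sphere 0 1"

definition sdist :: "real^3 \<Rightarrow> real^3 \<Rightarrow> real" where
  "sdist x y = arccos (x \<bullet> y)"

(* For non-antipodal distinct a, b on the sphere, the nonnegative combinations of a and b form the
   sector of the plane span {a, b} with angle sdist a b < pi at the origin, and it meets the great
   circle in its shorter part between a and b.  If a = b then the arc is {a}. *)
definition sarc :: "real^3 \<Rightarrow> real^3 \<Rightarrow> (real^3) set" where
  "sarc a b = {x \<in> S2. \<exists>s t. 0 \<le> s \<and> 0 \<le> t \<and> x = s *\<^sub>R a + t *\<^sub>R b}"

definition sconvex :: "(real^3) set \<Rightarrow> bool" where
  "sconvex C \<longleftrightarrow> C \<subseteq> S2 \<and> (\<forall>a\<in>C. - a \<notin> C) \<and> (\<forall>a\<in>C. \<forall>b\<in>C. sarc a b \<subseteq> C)"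

(* Interior and boundary are taken relative to the sphere, not in the ambient space. *)
abbreviation sinterior :: "(real^3) set \<Rightarrow> (real^3) set" where
  "sinterior C \<equiv> top_of_set S2 interior_of C"

abbreviation sbd :: "(real^3) set \<Rightarrow> (real^3) set" where
  "sbd C \<equiv> top_of_set S2 frontier_of C"

definition sconvex_body :: "(real^3) set \<Rightarrow> bool" where
  "sconvex_body C \<longleftrightarrow> sconvex C \<and> closedin (top_of_set S2) C \<and> sinterior C \<noteq> {}"

definition sdisk :: "real^3 \<Rightarrow> real \<Rightarrow> (real^3) set" where
  "sdisk c r = {x \<in> S2. sdist c x \<le> r}"

definition hemisphere :: "(real^3) set \<Rightarrow> bool" where
  "hemisphere K \<longleftrightarrow> (\<exists>c\<in>S2. K = sdisk c (pi / 2))"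

definition supports :: "(real^3) set \<Rightarrow> (real^3) set \<Rightarrow> bool" where
  "supports K C \<longleftrightarrow> hemisphere K \<and> C \<subseteq> K \<and> sbd C \<inter> sbd K \<noteq> {}"

(* The intersection of G and H is a lune. *)
definition lune_pair :: "(real^3) set \<Rightarrow> (real^3) set \<Rightarrow> bool" where
  "lune_pair G H \<longleftrightarrow>
     (\<exists>g\<in>S2. \<exists>h\<in>S2. G = sdisk g (pi / 2) \<and> H = sdisk h (pi / 2) \<and> g \<noteq> h \<and> g \<noteq> - h)"

(* The midpoint of the semicircle bounding the lune that lies in the boundary of G: the unique
   point of the semicircle equidistant from its two endpoints, which are the two points common to
   both boundary circles. *)
definition semicircle_center :: "(real^3) set \<Rightarrow> (real^3) set \<Rightarrow> real^3" where
  "semicircle_center G H =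
     (THE m. m \<in> sbd G \<inter> H \<and>
        (\<forall>p\<in>sbd G \<inter> sbd H. \<forall>q\<in>sbd G \<inter> sbd H. sdist m p = sdist m q))"

(* The thickness of the lune formed by G and H; meaningful only if lune_pair G H. *)
definition lune_thickness :: "(real^3) set \<Rightarrow> (real^3) set \<Rightarrow> real" where
  "lune_thickness G H = sdist (semicircle_center G H) (semicircle_center H G)"

(* The two minima are written as infima; by compactness both are attained when C is a convex
   body and K supports C. *)
definition width :: "(real^3) set \<Rightarrow> (real^3) set \<Rightarrow> real" where
  "width K C = (INF K' \<in> {K'. supports K' C \<and> lune_pair K K'}. lune_thickness K K')"

definition thickness :: "(real^3) set \<Rightarrow> real" where
  "thickness C = (INF K \<in> {K. supports K C}. width K C)"

definition reduced_body :: "(real^3) set \<Rightarrow> bool" where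
  "reduced_body R \<longleftrightarrow>
     sconvex_body R \<and> (\<forall>Z. sconvex_body Z \<and> Z \<subseteq> R \<and> Z \<noteq> R \<longrightarrow> thickness Z < thickness R)"

end

theory Submission imports Defs begin

text \<open>
  Let \<open>D\<close> be the thickness of \<open>R\<close> and put \<open>C = cos D\<close>, \<open>S = sin D\<close>.  The centre of the covering disk
  is the direction of the point \<open>q\<close> of the Euclidean convex hull of \<open>R\<close> that is closest to the origin.
  Every \<open>x\<close> in \<open>R\<close> satisfies \<open>q \<bullet> x \<ge> q \<bullet> q\<close>, so \<open>R\<close> lies in the disk around \<open>q / norm q\<close> whose radius
  has cosine \<open>norm q\<close>, and the theorem says that \<open>q \<bullet> q \<ge> (1 + C) / (3 - C)\<close>, the squared cosine of
  \<open>arctan (sqrt 2 * tan (D / 2))\<close>.  By Caratheodory's theorem \<open>q\<close> is a convex combination of at most three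
  points of \<open>R\<close> on the boundary of that disk, the contact points.

  Thickness is read off from the polar set of \<open>R\<close>: a hemisphere contains \<open>R\<close> iff its centre belongs to
  \<open>normals R\<close>, and the lune with centres \<open>g\<close> and \<open>h\<close> has thickness \<open>arccos (- (g \<bullet> h))\<close>; so \<open>D\<close> is
  \<open>pi\<close> minus the diameter of the polar set (\<open>thickness_normals\<close>).  Cutting a small cap off \<open>R\<close> at a contact
  point \<open>e\<close> makes \<open>R\<close> thinner, because \<open>R\<close> is reduced.  In the limit of smaller and smaller caps one obtains a
  lune of thickness \<open>D\<close> around \<open>R\<close> for which \<open>e\<close> is the centre of one of the two semicircles, while the
  centre of the other semicircle belongs to \<open>R\<close> as well (\<open>contact_touching_frame\<close>).  The arc between the two
  centres is called the chord at \<open>e\<close>; its length is \<open>D\<close>.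

  Any two chords cross (\<open>arcs_cross\<close>).  Hence each contact point is at distance at most \<open>D\<close> from the great
  circle that carries the chord at another contact point (\<open>touching_frame_extent\<close>).  Among the three contact
  points let \<open>e2\<close> be the one opposite to the shortest side.

  If \<open>e1\<close> and \<open>e3\<close> lie on one side of the chord at \<open>e2\<close>, then one explicit disk of the required radius
  contains all three points (\<open>half_square_covered\<close>); it is the circumscribed disk of an isosceles right
  triangle with legs \<open>D\<close>.  Otherwise the chord at \<open>e2\<close> crosses the side from \<open>e1\<close> to \<open>e3\<close>, so the altitude of the triangle
  at \<open>e2\<close> is at most \<open>D\<close>.  The triangle is not obtuse as a planar triangle, since \<open>q\<close> is its circumcentre and lies
  in its hull, and its longest side has cosine at least \<open>C\<^sup>2\<close>.  A computation with the squared side lengths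
  (\<open>dominant_squared_sides\<close>) shows that such a triangle with too large a circumradius would have a larger altitude at \<open>e2\<close>.
\<close>

unbundle cross3_syntax

section \<open>Orthonormal frames of space\<close>

lemma abs_inner_le_1: "norm x = 1 \<Longrightarrow> norm y = 1 \<Longrightarrow> \<bar>x \<bullet> y\<bar> \<le> 1" for x y :: "'a::real_inner"
  using Cauchy_Schwarz_ineq2[of x y] by simp

lemma inner_eq_1_unit:
  fixes x y :: "'a::real_inner"
  assumes "norm x = 1" "norm y = 1" "x \<bullet> y = 1"
  shows "x = y"
proof -
  have "(x - y) \<bullet> (x - y) = x \<bullet> x - 2 * (x \<bullet> y) + y \<bullet> y"
    by (simp add: inner_diff_left inner_diff_right inner_commute)
  also have "\<dots> = 0" using assms by (simp add: dot_square_norm)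
  finally show ?thesis by simp
qed

lemma abs_inner_less_1:
  assumes "norm g = 1" "norm h = 1" "g \<noteq> h" "g \<noteq> - h"
  shows "\<bar>g \<bullet> h\<bar> < 1"
proof -
  have "g \<bullet> h \<noteq> 1" using inner_eq_1_unit[of g h] assms by auto
  moreover have "g \<bullet> h \<noteq> -1" using inner_eq_1_unit[of g "- h"] assms by auto
  ultimately show ?thesis using abs_inner_le_1[of g h] assms by linarith
qed

lemma orthonormal_expansion:
  assumes u: "norm u = 1" "norm v = 1" "u \<bullet> v = 0"
  shows "x = (x \<bullet> u) *\<^sub>R u + (x \<bullet> v) *\<^sub>R v + (x \<bullet> (u \<times> v)) *\<^sub>R (u \<times> v)"
proof -
  have uu: "u \<bullet> u = 1" "v \<bullet> v = 1" using u by (simp_all add: dot_square_norm)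
  have nn: "(u \<times> v) \<bullet> (u \<times> v) = 1" using u uu by (simp add: dot_cross inner_commute)
  define y where "y = x - ((x \<bullet> u) *\<^sub>R u + (x \<bullet> v) *\<^sub>R v + (x \<bullet> (u \<times> v)) *\<^sub>R (u \<times> v))"
  have y: "y \<bullet> u = 0" "y \<bullet> v = 0" "y \<bullet> (u \<times> v) = 0"
    unfolding y_def using uu nn u(3) dot_cross_self
    by (simp_all add: inner_simps inner_commute)
  have "y \<times> (u \<times> v) = 0" using y by (simp add: Lagrange)
  then have "(norm y * norm (u \<times> v))\<^sup>2 = 0" using norm_cross_dot[of y "u \<times> v"] y by simp
  moreover have "norm (u \<times> v) = 1" using nn by (simp add: norm_eq_1)
  ultimately have "y = 0" by simp
  then show ?thesis by (simp add: y_def)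
qed

lemma norm_cross_orthonormal:
  assumes "norm u = 1" "norm v = 1" "u \<bullet> v = 0"
  shows "norm (u \<times> v) = 1"
  using assms by (simp add: norm_eq_1 dot_cross inner_commute)

lemma orthonormal_norm_square:
  assumes "norm u = 1" "norm v = 1" "u \<bullet> v = 0"
  shows "x \<bullet> x = (x \<bullet> u)\<^sup>2 + (x \<bullet> v)\<^sup>2 + (x \<bullet> (u \<times> v))\<^sup>2"
proof -
  have "x \<bullet> x = x \<bullet> ((x \<bullet> u) *\<^sub>R u + (x \<bullet> v) *\<^sub>R v + (x \<bullet> (u \<times> v)) *\<^sub>R (u \<times> v))"
    using orthonormal_expansion[OF assms, of x] by simp
  then show ?thesis by (simp add: inner_add_right power2_eq_square)
qed

lemma in_plane_expansion:
  assumes "norm p = 1" "norm n = 1" "p \<bullet> n = 0" "x \<bullet> n = 0"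
  shows "x = (x \<bullet> p) *\<^sub>R p + (x \<bullet> (n \<times> p)) *\<^sub>R (n \<times> p)"
  using orthonormal_expansion[of n p x] assms by (simp add: inner_commute)

lemma norm_orthogonal_part:
  assumes "norm g = 1" "norm h = 1"
  shows "norm (h - (g \<bullet> h) *\<^sub>R g) = sqrt (1 - (g \<bullet> h)\<^sup>2)"
proof -
  have gg: "g \<bullet> g = 1" "h \<bullet> h = 1" using assms by (simp_all add: dot_square_norm)
  have "(h - (g \<bullet> h) *\<^sub>R g) \<bullet> (h - (g \<bullet> h) *\<^sub>R g) = 1 - (g \<bullet> h)\<^sup>2"
    unfolding inner_diff_left inner_diff_right inner_scaleR_left inner_scaleR_right gg inner_commute[of h g]
    by (simp add: power2_eq_square)
  then show ?thesis by (simp add: norm_eq_sqrt_inner)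
qed

section \<open>Hemispheres and lunes\<close>

lemma mem_S2: "x \<in> S2 \<longleftrightarrow> norm x = 1" by (simp add: S2_def)

lemma mem_hemisphere:
  assumes "norm c = 1"
  shows "x \<in> sdisk c (pi / 2) \<longleftrightarrow> norm x = 1 \<and> 0 \<le> c \<bullet> x"
  using assms abs_inner_le_1[of c x] arccos_le_mono[of "c \<bullet> x" 0]
  by (auto simp: sdisk_def sdist_def mem_S2)

lemma mem_sinterior: "x \<in> sinterior C \<longleftrightarrow> norm x = 1 \<and> (\<exists>T. open T \<and> x \<in> T \<and> S2 \<inter> T \<subseteq> C)"
proof
  assume "x \<in> sinterior C"
  then show "norm x = 1 \<and> (\<exists>T. open T \<and> x \<in> T \<and> S2 \<inter> T \<subseteq> C)"
    unfolding interior_of_def openin_open by (auto simp: mem_S2)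
next
  assume "norm x = 1 \<and> (\<exists>T. open T \<and> x \<in> T \<and> S2 \<inter> T \<subseteq> C)"
  then obtain T where "x \<in> S2" "open T" "x \<in> T" "S2 \<inter> T \<subseteq> C" by (auto simp: mem_S2)
  then show "x \<in> sinterior C"
    unfolding interior_of_def openin_open by blast
qed

text \<open>
  If \<open>v\<close> were orthogonal to \<open>x0\<close>, then moving \<open>x0\<close> a little against \<open>v\<close> would stay in \<open>C\<close> and make the
  inner product negative.  This is how the nonempty interior of a convex body enters throughout.
\<close>

lemma interior_strictly_positive:
  assumes x0: "x0 \<in> sinterior C" and v: "v \<noteq> 0" and pos: "\<And>x. x \<in> C \<Longrightarrow> 0 \<le> v \<bullet> x"
  shows "0 < v \<bullet> x0"
proof (rule ccontr)
  assume not: "\<not> ?thesis"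
  obtain T where T: "open T" "x0 \<in> T" "S2 \<inter> T \<subseteq> C" and n0: "norm x0 = 1"
    using x0 by (auto simp: mem_sinterior)
  have "x0 \<in> C" using T n0 by (auto simp: mem_S2)
  then have 0: "v \<bullet> x0 = 0" using not pos by force
  define y where "y = (\<lambda>s. sgn (x0 - s *\<^sub>R v))"
  have "(y \<longlongrightarrow> sgn (x0 - 0 *\<^sub>R v)) (at_right 0)"
    unfolding y_def using n0 by (intro tendsto_intros) auto
  then have "(y \<longlongrightarrow> x0) (at_right 0)" using n0 by (simp add: sgn_div_norm)
  then have "\<forall>\<^sub>F s in at_right 0. y s \<in> T" using T by (simp add: topological_tendstoD)
  then have "\<forall>\<^sub>F s in at_right (0::real). y s \<in> T \<and> 0 < s"
    using eventually_at_right_less[of "0::real"] by eventually_elim auto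
  then obtain s where s: "y s \<in> T" "0 < s" 
    using eventually_happens[of _ "at_right (0::real)"] by (auto simp: trivial_limit_at_right_real)
  have neg: "v \<bullet> (x0 - s *\<^sub>R v) < 0" using 0 s v by (simp add: inner_diff_right)
  then have nz: "x0 - s *\<^sub>R v \<noteq> 0" by auto
  then have "y s \<in> S2" by (simp add: y_def mem_S2 norm_sgn)
  then have "0 \<le> v \<bullet> y s" using s T pos by auto
  moreover have "v \<bullet> y s < 0" using neg nz unfolding y_def sgn_div_norm
    by (simp add: mult_pos_neg)
  ultimately show False by simp
qed

lemma hemisphere_boundary:
  assumes g: "norm g = 1"
  shows "sbd (sdisk g (pi / 2)) = {x. norm x = 1 \<and> g \<bullet> x = 0}"
proof -
  let ?H = "sdisk g (pi / 2)"
  have H: "?H = S2 \<inter> {x. 0 \<le> g \<bullet> x}" by (auto simp: mem_hemisphere[OF g] mem_S2)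
  have "closedin (top_of_set S2) ?H"
    unfolding H by (rule closedin_closed_Int[OF closed_halfspace_ge])
  then have cl: "top_of_set S2 closure_of ?H = ?H" by (simp add: closure_of_closedin)
  have int: "x \<in> sinterior ?H \<longleftrightarrow> norm x = 1 \<and> 0 < g \<bullet> x" for x
  proof
    assume x: "x \<in> sinterior ?H"
    have "0 < g \<bullet> x" 
      by (rule interior_strictly_positive[OF x]) (use g in \<open>auto simp: mem_hemisphere\<close>)
    then show "norm x = 1 \<and> 0 < g \<bullet> x" using x by (simp add: mem_sinterior)
  next
    assume x: "norm x = 1 \<and> 0 < g \<bullet> x"
    have "open {y. 0 < g \<bullet> y}" by (rule open_halfspace_gt)
    then show "x \<in> sinterior ?H" unfolding mem_sinterior H using x
      by (intro conjI exI[of _ "{y. 0 < g \<bullet> y}"]) auto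
  qed
  show ?thesis unfolding frontier_of_def cl by (auto simp: int mem_hemisphere[OF g])
qed

text \<open>
  The two points common to both boundary circles are antipodal, so being equidistant from them means being
  orthogonal to both; together with \<open>g\<close> and their direction the projection of \<open>h\<close> along \<open>g\<close> completes an
  orthogonal frame, and the sign of the inner product with \<open>h\<close> selects the right one of two candidates.
\<close>

lemma lune_semicircle_center:
  assumes gh: "norm g = 1" "norm h = 1" "\<bar>g \<bullet> h\<bar> < 1"
  shows "semicircle_center (sdisk g (pi / 2)) (sdisk h (pi / 2)) = sgn (h - (g \<bullet> h) *\<^sub>R g)"
proof -
  define k where "k = h - (g \<bullet> h) *\<^sub>R g"
  define m where "m = sgn k"
  have gg: "g \<bullet> g = 1" "h \<bullet> h = 1" using gh by (simp_all add: dot_square_norm)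
  have nk2: "(norm k)\<^sup>2 = 1 - (g \<bullet> h)\<^sup>2"
    unfolding k_def norm_orthogonal_part[OF gh(1,2)] using gh(3) by (simp add: abs_square_le_1 less_imp_le)
  have pos: "0 < 1 - (g \<bullet> h)\<^sup>2" using gh(3) by (simp add: abs_square_less_1)
  then have k0: "k \<noteq> 0" using nk2 by auto
  have m1: "norm m = 1" using k0 by (simp add: m_def norm_sgn)
  have km: "k = norm k *\<^sub>R m" using k0 by (simp add: m_def sgn_div_norm)
  have gk: "g \<bullet> k = 0" using gg by (simp add: k_def inner_diff_right)
  then have gm: "g \<bullet> m = 0" by (simp add: m_def sgn_div_norm)
  have h_eq: "h = (g \<bullet> h) *\<^sub>R g + norm k *\<^sub>R m" using km by (simp add: k_def)
  have hm: "h \<bullet> m = norm k" by (subst h_eq) (use gm m1 in \<open>simp add: inner_add_left dot_square_norm\<close>)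
  have gm': "norm (g \<times> m) = 1" using norm_cross_orthonormal gh m1 gm by blast
  let ?P = "\<lambda>y. y \<in> sbd (sdisk g (pi / 2)) \<inter> sdisk h (pi / 2) \<and>
     (\<forall>p\<in>sbd (sdisk g (pi / 2)) \<inter> sbd (sdisk h (pi / 2)).
       \<forall>q\<in>sbd (sdisk g (pi / 2)) \<inter> sbd (sdisk h (pi / 2)). sdist y p = sdist y q)"
  have bd: "p \<in> sbd (sdisk g (pi / 2)) \<inter> sbd (sdisk h (pi / 2)) \<longleftrightarrow> norm p = 1 \<and> g \<bullet> p = 0 \<and> m \<bullet> p = 0" for p
  proof -
    have "h \<bullet> p = norm k * (m \<bullet> p)" if "g \<bullet> p = 0"
      using that by (subst h_eq) (simp add: inner_add_left)
    then show ?thesis using k0 by (auto simp: hemisphere_boundary gh)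
  qed
  have "(THE y. ?P y) = m"
  proof (rule the_equality)
    show "?P m"
    proof
      show "m \<in> sbd (sdisk g (pi / 2)) \<inter> sdisk h (pi / 2)"
        using m1 gm hm by (simp add: hemisphere_boundary mem_hemisphere gh)
    qed (use bd in \<open>auto simp: sdist_def\<close>)
  next
    fix y assume y: "?P y"
    then have y1: "norm y = 1" "g \<bullet> y = 0" "0 \<le> h \<bullet> y"
      by (auto simp: hemisphere_boundary mem_hemisphere gh)
    have "g \<times> m \<in> sbd (sdisk g (pi / 2)) \<inter> sbd (sdisk h (pi / 2))"
      "- (g \<times> m) \<in> sbd (sdisk g (pi / 2)) \<inter> sbd (sdisk h (pi / 2))"
      using gm' unfolding bd by (simp_all add: dot_cross_self)
    then have "sdist y (g \<times> m) = sdist y (- (g \<times> m))" using y by blast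
    moreover have "\<bar>y \<bullet> (g \<times> m)\<bar> \<le> 1" using abs_inner_le_1 y1 gm' by blast
    ultimately have "y \<bullet> (g \<times> m) = - (y \<bullet> (g \<times> m))"
      unfolding sdist_def by (metis abs_minus_cancel arccos_eq_iff inner_minus_right)
    then have y0: "y \<bullet> (g \<times> m) = 0" by simp
    have y_eq: "y = (y \<bullet> m) *\<^sub>R m"
      using orthonormal_expansion[OF gh(1) m1 gm, of y] y0 y1 by (simp add: inner_commute)
    have "0 \<le> (y \<bullet> m) * norm k" using y1(3) hm by (subst (asm) y_eq) simp
    then have "0 \<le> y \<bullet> m" using k0 by (simp add: zero_le_mult_iff)
    moreover have "\<bar>y \<bullet> m\<bar> = 1" using y1 m1 y_eq by (metis mult.right_neutral norm_scaleR)
    ultimately show "y = m" using y_eq by simp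
  qed
  then show ?thesis unfolding semicircle_center_def m_def k_def by simp
qed

text \<open>
  The angle of a lune and the angle between the centres of its two hemispheres are supplementary.
\<close>

lemma lune_thickness_normals:
  assumes gh: "norm g = 1" "norm h = 1" "\<bar>g \<bullet> h\<bar> < 1"
  shows "lune_thickness (sdisk g (pi / 2)) (sdisk h (pi / 2)) = arccos (- (g \<bullet> h))"
proof -
  let ?u = "h - (g \<bullet> h) *\<^sub>R g" and ?v = "g - (h \<bullet> g) *\<^sub>R h"
  have gg: "g \<bullet> g = 1" "h \<bullet> h = 1" using gh by (simp_all add: dot_square_norm)
  have comm: "h \<bullet> g = g \<bullet> h" by (rule inner_commute)
  have hg: "\<bar>h \<bullet> g\<bar> < 1" unfolding comm by (rule gh(3))
  have pos: "0 < 1 - (g \<bullet> h)\<^sup>2" using gh(3) by (simp add: abs_square_less_1)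
  have n: "norm ?u = sqrt (1 - (g \<bullet> h)\<^sup>2)" "norm ?v = sqrt (1 - (g \<bullet> h)\<^sup>2)"
    using norm_orthogonal_part[OF gh(1,2)] norm_orthogonal_part[OF gh(2,1)] unfolding comm .
  have uv: "?u \<bullet> ?v = - (g \<bullet> h) * (1 - (g \<bullet> h)\<^sup>2)"
    unfolding inner_diff_left inner_diff_right inner_scaleR_left inner_scaleR_right gg comm
    by (simp add: power2_eq_square algebra_simps)
  have "sgn ?u \<bullet> sgn ?v = (?u \<bullet> ?v) / (norm ?u * norm ?v)"
    by (simp add: sgn_div_norm divide_inverse)
  also have "\<dots> = - (g \<bullet> h)" unfolding n uv using pos by simp
  finally show ?thesis
    unfolding lune_thickness_def lune_semicircle_center[OF gh] lune_semicircle_center[OF gh(2,1) hg] sdist_def by simp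
qed

lemma lune_pairI:
  assumes "norm g = 1" "norm h = 1" "\<bar>g \<bullet> h\<bar> < 1"
  shows "lune_pair (sdisk g (pi / 2)) (sdisk h (pi / 2))"
proof -
  have "g \<noteq> h" "g \<noteq> - h" using assms by (auto simp: dot_square_norm)
  then show ?thesis using assms unfolding lune_pair_def mem_S2[symmetric] by blast
qed

section \<open>Spherically convex bodies and their polar sets\<close>

lemma sconvex_body_compact:
  assumes "sconvex_body C" shows "compact C"
  using assms closedin_compact[of S2 C] by (simp add: sconvex_body_def S2_def)

lemma sconvex_body_norm: "sconvex_body C \<Longrightarrow> x \<in> C \<Longrightarrow> norm x = 1"
  by (auto simp: sconvex_body_def sconvex_def mem_S2)

lemma sconvex_body_nonempty: "sconvex_body C \<Longrightarrow> C \<noteq> {}"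
  using interior_of_subset[of "top_of_set S2" C] by (auto simp: sconvex_body_def)

lemma sconvex_combination:
  assumes C: "sconvex C" and ab: "a \<in> C" "b \<in> C" and st: "0 \<le> s" "0 \<le> t" "0 < s + t"
  shows "s *\<^sub>R a + t *\<^sub>R b \<noteq> 0 \<and> sgn (s *\<^sub>R a + t *\<^sub>R b) \<in> C"
proof
  have n: "norm a = 1" "norm b = 1" using C ab by (auto simp: sconvex_def mem_S2)
  show nz: "s *\<^sub>R a + t *\<^sub>R b \<noteq> 0"
  proof
    assume 0: "s *\<^sub>R a + t *\<^sub>R b = 0"
    then have e: "s *\<^sub>R a = - (t *\<^sub>R b)" by (simp add: add_eq_0_iff2)
    then have "norm (s *\<^sub>R a) = norm (t *\<^sub>R b)" by simp
    then have "s = t" using n st by simp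
    then have "s *\<^sub>R a = s *\<^sub>R (- b)" "s \<noteq> 0" using e st by auto
    then have "a = - b" by (simp only: scaleR_cancel_left) simp
    then have "b = - a" by simp
    then show False using C ab by (auto simp: sconvex_def)
  qed
  let ?y = "s *\<^sub>R a + t *\<^sub>R b"
  have "sgn ?y = (s / norm ?y) *\<^sub>R a + (t / norm ?y) *\<^sub>R b"
    by (simp add: sgn_div_norm scaleR_right_distrib divide_inverse mult.commute)
  moreover have "norm (sgn ?y) = 1" using nz by (simp add: norm_sgn)
  ultimately have "sgn ?y \<in> sarc a b" using st unfolding sarc_def mem_S2 
    by (metis (mono_tags, lifting) divide_nonneg_nonneg mem_Collect_eq mem_S2 norm_ge_zero)
  moreover have "sarc a b \<subseteq> C" using C ab unfolding sconvex_def by blast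
  ultimately show "sgn ?y \<in> C" by blast
qed

text \<open>
  The cone over a spherically convex set remains convex when its apex is removed, because the set contains no
  antipodes.
\<close>

lemma sgn_hull:
  assumes C: "sconvex C" and x: "x \<in> convex hull C"
  shows "x \<noteq> 0 \<and> sgn x \<in> C"
proof -
  let ?K = "{x. x \<noteq> 0 \<and> sgn x \<in> C}"
  have "convex ?K"
    unfolding convex_def
  proof (intro ballI allI impI)
    fix x y and u v :: real
    assume xy: "x \<in> ?K" "y \<in> ?K" and uv: "0 \<le> u" "0 \<le> v" "u + v = 1"
    have e: "u *\<^sub>R x + v *\<^sub>R y = (u * norm x) *\<^sub>R sgn x + (v * norm y) *\<^sub>R sgn y"
    proof -
      have "z = norm z *\<^sub>R sgn z" for z :: "real^3" by (cases "z = 0") (simp_all add: sgn_div_norm)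
      then show ?thesis by (metis scaleR_scaleR)
    qed
    have "0 < u * norm x + v * norm y"
      using xy uv by (cases "u = 0") (auto intro: add_pos_nonneg)
    then show "u *\<^sub>R x + v *\<^sub>R y \<in> ?K" unfolding e
      using sconvex_combination[OF C, of "sgn x" "sgn y" "u * norm x" "v * norm y"] xy uv by simp
  qed
  moreover have "C \<subseteq> ?K"
  proof
    fix x assume "x \<in> C"
    moreover from this have "norm x = 1" using C by (auto simp: sconvex_def mem_S2)
    ultimately show "x \<in> ?K" by (auto simp: sgn_div_norm)
  qed
  ultimately show ?thesis using x hull_minimal[of C ?K convex] by blast
qed

text \<open>
  The hull of a convex body misses the origin, so the two can be separated strictly.
\<close>

lemma strictly_positive_normal:
  assumes C: "sconvex_body C"
  obtains v b where "0 < b" "\<And>x. x \<in> C \<Longrightarrow> b < v \<bullet> x"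
proof -
  have "closed (convex hull C)"
    using sconvex_body_compact[OF C] by (simp add: compact_convex_hull compact_imp_closed)
  moreover have "0 \<notin> convex hull C" using sgn_hull C unfolding sconvex_body_def by blast
  ultimately obtain v b where "0 < b" "\<forall>x\<in>convex hull C. b < v \<bullet> x"
    using separating_hyperplane_closed_0[of "convex hull C"] by auto
  then show thesis using that hull_inc by metis
qed

definition normals :: "(real^3) set \<Rightarrow> (real^3) set" where
  "normals C = {g. norm g = 1 \<and> (\<forall>x\<in>C. 0 \<le> g \<bullet> x)}"

text \<open>
  A convex body is the intersection of the hemispheres that contain it.  A hyperplane separating the ray
  through \<open>m\<close> from the hull of \<open>C\<close> need only be weakly negative on \<open>m\<close>; as it is bounded below by a positive
  number on \<open>C\<close>, it can be tilted to become strictly negative on \<open>m\<close>.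
\<close>

lemma bipolar:
  assumes C: "sconvex_body C" and m: "m \<noteq> 0" and pos: "\<And>w. w \<in> normals C \<Longrightarrow> 0 \<le> w \<bullet> m"
  shows "sgn m \<in> C"
proof (rule ccontr)
  assume not: "sgn m \<notin> C"
  define ray where "ray = (\<lambda>s. s *\<^sub>R m) ` {0::real..}"
  have ray: "convex ray" "closed ray"
    unfolding ray_def
  proof -
    show "convex ((\<lambda>s. s *\<^sub>R m) ` {0::real..})"
      by (intro convex_linear_image linear_scaleR_left) simp
    show "closed ((\<lambda>s. s *\<^sub>R m) ` {0::real..})"
      using m by (intro closed_injective_linear_image) (auto simp: linear_scaleR_left inj_def)
  qed
  have "ray \<inter> convex hull C = {}"
  proof (rule ccontr)
    assume "\<not> ?thesis"
    then obtain s where s: "0 \<le> s" "s *\<^sub>R m \<in> convex hull C" by (auto simp: ray_def)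
    have "sconvex C" using C by (simp add: sconvex_body_def)
    from sgn_hull[OF this s(2)] have "s *\<^sub>R m \<noteq> 0" "sgn (s *\<^sub>R m) \<in> C" by auto
    then show False using not s by (auto simp: sgn_scaleR)
  qed
  then obtain a b where ab: "\<forall>x\<in>ray. a \<bullet> x < b" "\<forall>x\<in>convex hull C. b < a \<bullet> x"
    using separating_hyperplane_closed_compact[OF ray convex_convex_hull, of C]
      compact_convex_hull[OF sconvex_body_compact[OF C]] sconvex_body_nonempty[OF C] by auto
  have b: "0 < b" using ab(1) by (force simp: ray_def)
  have am: "a \<bullet> m \<le> 0"
  proof (rule ccontr)
    assume "\<not> ?thesis"
    then have p: "0 < a \<bullet> m" by simp
    have "(b / (a \<bullet> m)) *\<^sub>R m \<in> ray" unfolding ray_def using p b by (intro imageI) simp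
    then have "a \<bullet> ((b / (a \<bullet> m)) *\<^sub>R m) < b" using ab(1) by blast
    then show False using p by simp
  qed
  \<comment> \<open>The size of the tilt: it changes values on unit vectors by at most \<open>b / 2\<close>.\<close>
  define w where "w = a - (b / (2 * norm m)) *\<^sub>R m"
  have wC: "0 < w \<bullet> x" if x: "x \<in> C" for x
  proof -
    have "m \<bullet> x \<le> norm m" using norm_cauchy_schwarz[of m x] sconvex_body_norm[OF C x] by simp
    then have "(b / (2 * norm m)) * (m \<bullet> x) \<le> (b / (2 * norm m)) * norm m"
      using b m by (intro mult_left_mono) auto
    also have "\<dots> = b / 2" using m by simp
    finally show ?thesis using ab(2) x b hull_inc[of x C convex] unfolding w_def by (force simp: inner_diff_left)
  qed
  have w0: "w \<noteq> 0" using wC sconvex_body_nonempty[OF C] by force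
  have "0 < (b / (2 * norm m)) * (m \<bullet> m)" using b m by simp
  then have "w \<bullet> m < 0" using am unfolding w_def inner_diff_left inner_scaleR_left by linarith
  moreover have "sgn w \<in> normals C"
    using wC w0 by (auto simp: normals_def norm_sgn sgn_div_norm less_imp_le)
  then have "0 \<le> sgn w \<bullet> m" by (rule pos)
  then have "0 \<le> w \<bullet> m" using w0 by (simp add: sgn_div_norm zero_le_mult_iff)
  ultimately show False by simp
qed

lemma compact_normals: "compact (normals C)"
proof -
  have "normals C = sphere 0 1 \<inter> (\<Inter>x\<in>C. {g. 0 \<le> x \<bullet> g})"
    by (auto simp: normals_def inner_commute)
  moreover have "closed (\<Inter>x\<in>C. {g. 0 \<le> x \<bullet> g})"
    using closed_halfspace_ge[of 0] by (intro closed_INT) auto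
  ultimately show ?thesis by (simp add: compact_Int_closed)
qed

lemma normals_not_opposite:
  assumes C: "sconvex_body C" and g: "g \<in> normals C" shows "- g \<notin> normals C"
proof
  assume g': "- g \<in> normals C"
  obtain x0 where x0: "x0 \<in> sinterior C" using C by (auto simp: sconvex_body_def)
  have "g \<noteq> 0" using g by (auto simp: normals_def)
  then have "0 < g \<bullet> x0" using interior_strictly_positive[OF x0] g by (auto simp: normals_def)
  moreover have "x0 \<in> C" using interior_of_subset[of _ C] x0 by auto
  ultimately show False using g' by (force simp: normals_def)
qed

text \<open>
  The polar set of a convex body is not a single point, since a strictly positive functional
  remains positive after a small change of direction.
\<close>

lemma another_normal:
  assumes C: "sconvex_body C" obtains h where "h \<in> normals C" "h \<noteq> g"
proof -
  obtain v b where vb: "0 < b" "\<And>x. x \<in> C \<Longrightarrow> b < v \<bullet> x" using strictly_positive_normal[OF C] by metis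
  obtain x where x: "x \<in> C" using sconvex_body_nonempty[OF C] by auto
  have v0: "v \<noteq> 0" using vb x by fastforce
  obtain u' :: "real^3" where u': "u' \<noteq> 0" "orthogonal v u'"
    using orthogonal_to_vector_exists[of v] by auto
  define u where "u = sgn u'"
  have u: "norm u = 1" "v \<bullet> u = 0" using u' by (auto simp: u_def norm_sgn sgn_div_norm orthogonal_def)
  define w where "w = v + b *\<^sub>R u"
  have wC: "0 < w \<bullet> x" if "x \<in> C" for x
  proof -
    have "\<bar>u \<bullet> x\<bar> \<le> 1" using abs_inner_le_1 u sconvex_body_norm[OF C that] by blast
    then have "b * (- 1) \<le> b * (u \<bullet> x)" using vb(1) by (intro mult_left_mono) auto
    then show ?thesis using vb(2)[OF that] by (simp add: w_def inner_add_left)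
  qed
  have w0: "w \<noteq> 0" using wC x by force
  have "sgn v \<in> normals C" "sgn w \<in> normals C"
    using vb wC v0 w0 by (auto simp: normals_def norm_sgn sgn_div_norm intro!: less_imp_le[OF mult_pos_pos] intro: less_trans)
  moreover have "sgn v \<noteq> sgn w"
  proof
    assume "sgn v = sgn w"
    then have "sgn v \<bullet> u = sgn w \<bullet> u" by simp
    moreover have "w \<bullet> u = b" using u by (simp add: w_def inner_add_left dot_square_norm)
    ultimately show False using u vb w0 by (simp add: sgn_div_norm)
  qed
  ultimately show thesis using that by metis
qed

text \<open>
  If \<open>h\<close> is a point of the polar set farthest from \<open>g\<close>, then the centre of the semicircle bounding the lune
  on the side of \<open>h\<close> belongs to \<open>C\<close>.  Otherwise, by the bipolar theorem, some normal \<open>w\<close> is negative on that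
  centre, and moving \<open>h\<close> towards \<open>w\<close> would increase the distance from \<open>g\<close>.
\<close>

lemma farthest_normal_foot:
  assumes C: "sconvex_body C" and h: "h \<in> normals C" and g: "norm g = 1"
    and min: "\<And>w. w \<in> normals C \<Longrightarrow> g \<bullet> h \<le> g \<bullet> w" and gh: "\<bar>g \<bullet> h\<bar> < 1"
  shows "sgn (g - (g \<bullet> h) *\<^sub>R h) \<in> C"
proof (rule bipolar[OF C])
  define c where "c = g \<bullet> h"
  have h1: "norm h = 1" using h by (simp add: normals_def)
  have hh: "h \<bullet> h = 1" using h1 by (simp add: dot_square_norm)
  show "g - (g \<bullet> h) *\<^sub>R h \<noteq> 0"
  proof
    assume "g - (g \<bullet> h) *\<^sub>R h = 0"
    then have "norm g = \<bar>g \<bullet> h\<bar> * norm h" by (metis eq_iff_diff_eq_0 norm_scaleR)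
    then show False using g h1 gh by simp
  qed
  fix w assume w: "w \<in> normals C"
  have ww: "w \<bullet> w = 1" using w by (simp add: normals_def dot_square_norm)
  show "0 \<le> w \<bullet> (g - (g \<bullet> h) *\<^sub>R h)"
  proof (rule ccontr)
    assume "\<not> ?thesis"
    then have neg: "g \<bullet> w - c * (h \<bullet> w) < 0" by (simp add: inner_diff_right inner_commute c_def)
    \<comment> \<open>Up to the positive factor \<open>norm k\<close>, this compares the cosines of the distances from \<open>g\<close> to the
      moved normal \<open>k\<close> and to \<open>h\<close>.\<close>
    define f where "f = (\<lambda>t::real. c + t * (g \<bullet> w) - c * sqrt (1 + 2 * t * (h \<bullet> w) + t\<^sup>2))"
    have "(f has_real_derivative (g \<bullet> w - c * (h \<bullet> w))) (at 0)"
      unfolding f_def by (auto intro!: derivative_eq_intros)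
    then obtain d where d: "0 < d" "\<And>t. 0 < t \<Longrightarrow> t < d \<Longrightarrow> f (0 + t) < f 0"
      using DERIV_neg_dec_right[OF _ neg] by blast
    define t where "t = min (d / 2) (1 / 2)"
    have t: "0 < t" "t < d" "t < 1" using d by (auto simp: t_def)
    have ft: "f t < 0" using d(2)[OF t(1,2)] by (simp add: f_def)
    define k where "k = h + t *\<^sub>R w"
    have nk: "norm k = sqrt (1 + 2 * t * (h \<bullet> w) + t\<^sup>2)"
      unfolding norm_eq_sqrt_inner k_def using hh ww
      by (simp add: inner_add_left inner_add_right inner_commute power2_eq_square algebra_simps)
    have k0: "k \<noteq> 0"
    proof
      assume "k = 0"
      then have "h = - (t *\<^sub>R w)" by (simp add: k_def add_eq_0_iff2)
      then have "norm h = t * norm w" using t by simp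
      then show False using t h1 w by (simp add: normals_def)
    qed
    have "sgn k \<in> normals C" using h w k0 t
      by (auto simp: normals_def norm_sgn sgn_div_norm k_def inner_add_left)
    then have "c \<le> g \<bullet> sgn k" using min by (simp add: c_def)
    then have "c * norm k \<le> g \<bullet> k" using k0 by (simp add: sgn_div_norm field_simps)
    then have "0 \<le> f t" unfolding f_def nk by (simp add: k_def inner_add_right c_def)
    then show False using ft by simp
  qed
qed

section \<open>Thickness as the diameter of the polar set\<close>

lemma hemisphere_supports:
  assumes C: "sconvex_body C" and g: "g \<in> normals C" and m: "m \<in> C" "g \<bullet> m = 0"
  shows "supports (sdisk g (pi / 2)) C"
proof -
  have g1: "norm g = 1" using g by (simp add: normals_def)
  have "closedin (top_of_set S2) C" using C by (simp add: sconvex_body_def)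
  then have cl: "top_of_set S2 closure_of C = C" by (simp add: closure_of_closedin)
  have "m \<notin> sinterior C"
  proof
    assume "m \<in> sinterior C"
    then have "0 < g \<bullet> m" by (rule interior_strictly_positive) (use g g1 in \<open>auto simp: normals_def\<close>)
    then show False using m by simp
  qed
  then have "m \<in> sbd C" using m by (simp add: frontier_of_def cl)
  moreover have "m \<in> sbd (sdisk g (pi / 2))"
    using m g1 sconvex_body_norm[OF C m(1)] by (simp add: hemisphere_boundary)
  moreover have "C \<subseteq> sdisk g (pi / 2)"
    using g sconvex_body_norm[OF C] by (auto simp: mem_hemisphere[OF g1] normals_def)
  ultimately show ?thesis using g1 unfolding supports_def hemisphere_def by (auto simp: mem_S2)
qed

lemma supports_normal:
  assumes "supports K C" "K = sdisk g (pi / 2)" "norm g = 1"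
  shows "g \<in> normals C"
  using assms by (auto simp: supports_def normals_def mem_hemisphere subset_iff)

lemma supports_sides:
  assumes "supports K C" "supports K' C" "lune_pair K K'"
  obtains g h where "K = sdisk g (pi / 2)" "K' = sdisk h (pi / 2)" 
    "g \<in> normals C" "h \<in> normals C" "\<bar>g \<bullet> h\<bar> < 1"
proof -
  obtain g h where gh: "norm g = 1" "norm h = 1" "K = sdisk g (pi / 2)" "K' = sdisk h (pi / 2)" "g \<noteq> h" "g \<noteq> - h"
    using assms(3) by (auto simp: lune_pair_def mem_S2)
  show thesis using that[OF gh(3,4)] supports_normal assms abs_inner_less_1 gh by blast
qed

text \<open>
  The foot provided by \<open>farthest_normal_foot\<close> is a point of \<open>C\<close> on the boundary of the hemisphere around \<open>h\<close>.
  In particular every supporting hemisphere has a partner with which it forms a lune, so the infimum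
  in the definition of \<open>width\<close> is over a nonempty set.
\<close>

lemma farthest_normal:
  assumes C: "sconvex_body C" and g: "g \<in> normals C"
  obtains h where "h \<in> normals C" "\<And>w. w \<in> normals C \<Longrightarrow> g \<bullet> h \<le> g \<bullet> w" "\<bar>g \<bullet> h\<bar> < 1"
    "supports (sdisk h (pi / 2)) C"
proof -
  have "continuous_on (normals C) (\<lambda>h. g \<bullet> h)" by (intro continuous_intros)
  then obtain h where h: "h \<in> normals C" and min: "\<And>w. w \<in> normals C \<Longrightarrow> g \<bullet> h \<le> g \<bullet> w"
    using continuous_attains_inf[OF compact_normals] g by blast
  have n: "norm g = 1" "norm h = 1" using g h by (auto simp: normals_def)
  obtain w where w: "w \<in> normals C" "w \<noteq> g" using another_normal[OF C] by metis
  have "g \<bullet> h \<noteq> 1"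
  proof
    assume "g \<bullet> h = 1"
    then have "1 \<le> g \<bullet> w" using min w by force
    moreover have "\<bar>g \<bullet> w\<bar> \<le> 1" using n w abs_inner_le_1 by (auto simp: normals_def)
    ultimately have "g \<bullet> w = 1" by simp
    then show False using inner_eq_1_unit[of g w] n w by (auto simp: normals_def)
  qed
  moreover have "g \<noteq> - h" using normals_not_opposite[OF C h] g by auto
  ultimately have gh: "\<bar>g \<bullet> h\<bar> < 1" using abs_inner_less_1[OF n] n by (cases "g = h") (auto simp: dot_square_norm)
  have "sgn (g - (g \<bullet> h) *\<^sub>R h) \<in> C" by (rule farthest_normal_foot[OF C h n(1) min gh])
  moreover have "h \<bullet> sgn (g - (g \<bullet> h) *\<^sub>R h) = 0"
    using n by (simp add: sgn_div_norm inner_diff_right inner_commute dot_square_norm)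
  ultimately have "supports (sdisk h (pi / 2)) C" by (rule hemisphere_supports[OF C h])
  then show thesis using that h min gh by blast
qed

text \<open>
  A pair of normals at maximal distance exists by compactness.  Both hemispheres of the pair touch \<open>C\<close>, by
  \<open>farthest_normal_foot\<close>, so the pair is admissible in the definition of thickness and attains the infimum.
\<close>

lemma thickness_normals:
  assumes C: "sconvex_body C"
  shows "\<exists>g\<in>normals C. \<exists>h\<in>normals C. \<bar>g \<bullet> h\<bar> < 1 \<and>
    (\<forall>g'\<in>normals C. \<forall>h'\<in>normals C. g \<bullet> h \<le> g' \<bullet> h') \<and> thickness C = arccos (- (g \<bullet> h))"
proof -
  obtain g0 where g0: "g0 \<in> normals C" using another_normal[OF C] by metis
  let ?N = "Sigma (normals C) (\<lambda>_. normals C)"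
  have "compact ?N" by (intro compact_Times compact_normals)
  moreover have "?N \<noteq> {}" using g0 by blast
  moreover have "continuous_on ?N (\<lambda>p. fst p \<bullet> snd p)" by (intro continuous_intros)
  ultimately have "\<exists>p\<in>?N. \<forall>r\<in>?N. fst p \<bullet> snd p \<le> fst r \<bullet> snd r" by (rule continuous_attains_inf)
  then obtain p where p: "p \<in> ?N" "\<And>r. r \<in> ?N \<Longrightarrow> fst p \<bullet> snd p \<le> fst r \<bullet> snd r" by blast
  define g h where "g = fst p" and "h = snd p"
  have gn: "g \<in> normals C" and hn: "h \<in> normals C" using p(1) by (auto simp: g_def h_def)
  have min: "g \<bullet> h \<le> g' \<bullet> h'" if "g' \<in> normals C" "h' \<in> normals C" for g' h'
    using p(2)[of "(g', h')"] that by (simp add: g_def h_def)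
  have n: "norm g = 1" "norm h = 1" using gn hn by (auto simp: normals_def)
  obtain h1 where h1: "h1 \<in> normals C" "\<And>w. w \<in> normals C \<Longrightarrow> g \<bullet> h1 \<le> g \<bullet> w" "\<bar>g \<bullet> h1\<bar> < 1"
    using farthest_normal[OF C gn] by metis
  have "g \<bullet> h1 = g \<bullet> h" using h1 min gn hn by (meson order_antisym)
  then have gh: "\<bar>g \<bullet> h\<bar> < 1" using h1 by simp
  have sup: "supports (sdisk y (pi / 2)) C"
    if y: "y \<in> normals C" "x \<in> normals C" and m: "\<And>w. w \<in> normals C \<Longrightarrow> x \<bullet> y \<le> x \<bullet> w" and xy: "\<bar>x \<bullet> y\<bar> < 1" for x y
  proof -
    have xy1: "norm x = 1" "norm y = 1" using y by (auto simp: normals_def)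
    have "sgn (x - (x \<bullet> y) *\<^sub>R y) \<in> C" by (rule farthest_normal_foot[OF C y(1) xy1(1) m xy])
    moreover have "y \<bullet> sgn (x - (x \<bullet> y) *\<^sub>R y) = 0"
      using xy1 by (simp add: sgn_div_norm inner_diff_right inner_commute dot_square_norm)
    ultimately show ?thesis by (rule hemisphere_supports[OF C y(1)])
  qed
  have sh: "supports (sdisk h (pi / 2)) C" by (rule sup[OF hn gn min[OF gn] gh])
  have sg: "supports (sdisk g (pi / 2)) C"
    by (rule sup[OF gn hn]) (use min hn gh in \<open>auto simp: inner_commute\<close>)
  let ?W = "\<lambda>K. {K'. supports K' C \<and> lune_pair K K'}"
  have val: "arccos (- (g \<bullet> h)) \<le> lune_thickness K K'" "0 \<le> lune_thickness K K'"
    if K: "supports K C" "K' \<in> ?W K" for K K'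
  proof -
    obtain g' h' where K_eq: "K = sdisk g' (pi / 2)" "K' = sdisk h' (pi / 2)"
      and g': "g' \<in> normals C" "h' \<in> normals C" "\<bar>g' \<bullet> h'\<bar> < 1"
      using supports_sides[of K C K'] K by auto
    have eq: "lune_thickness K K' = arccos (- (g' \<bullet> h'))"
      unfolding K_eq by (rule lune_thickness_normals) (use g' in \<open>auto simp: normals_def\<close>)
    show "arccos (- (g \<bullet> h)) \<le> lune_thickness K K'" "0 \<le> lune_thickness K K'"
      unfolding eq using min[OF g'(1,2)] gh g' by (auto simp: arccos_le_mono intro!: arccos_lbound)
  qed
  have ne: "?W K \<noteq> {}" if K: "supports K C" for K
  proof -
    obtain g' where g': "norm g' = 1" "K = sdisk g' (pi / 2)" using K unfolding supports_def hemisphere_def mem_S2[symmetric] by blast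
    have g'n: "g' \<in> normals C" using supports_normal K g' by blast
    obtain h' where h': "h' \<in> normals C" "\<bar>g' \<bullet> h'\<bar> < 1" "supports (sdisk h' (pi / 2)) C"
      using farthest_normal[OF C g'n] by metis
    then have "lune_pair K (sdisk h' (pi / 2))" using lune_pairI g' by (auto simp: normals_def)
    then show ?thesis using h' by blast
  qed
  have w_ge: "arccos (- (g \<bullet> h)) \<le> width K C" if "supports K C" for K
    unfolding width_def by (rule cINF_greatest[OF ne[OF that]]) (use val that in auto)
  have "width (sdisk g (pi / 2)) C \<le> lune_thickness (sdisk g (pi / 2)) (sdisk h (pi / 2))"
    unfolding width_def
  proof (rule cINF_lower)
    show "bdd_below (lune_thickness (sdisk g (pi / 2)) ` ?W (sdisk g (pi / 2)))"
      using val(2)[OF sg] by (intro bdd_belowI[of _ 0]) auto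
    show "sdisk h (pi / 2) \<in> ?W (sdisk g (pi / 2))" using sh lune_pairI[OF n gh] by simp
  qed
  also have "\<dots> = arccos (- (g \<bullet> h))" by (rule lune_thickness_normals[OF n gh])
  finally have w_le: "width (sdisk g (pi / 2)) C \<le> arccos (- (g \<bullet> h))" .
  have "thickness C = arccos (- (g \<bullet> h))"
  proof (rule antisym)
    have "thickness C \<le> width (sdisk g (pi / 2)) C"
      unfolding thickness_def
      by (rule cINF_lower) (use sg w_ge in \<open>auto intro!: bdd_belowI[of _ "arccos (- (g \<bullet> h))"]\<close>)
    then show "thickness C \<le> arccos (- (g \<bullet> h))" using w_le by simp
    show "arccos (- (g \<bullet> h)) \<le> thickness C"
      unfolding thickness_def by (rule cINF_greatest) (use sg w_ge in auto)
  qed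
  then show ?thesis using gn hn gh min by blast
qed

section \<open>Lunes touching a reduced body at a contact point\<close>

text \<open>
  With \<open>C = cos D\<close>, \<open>S = sin D\<close> and \<open>e\<close>, \<open>g\<close> orthonormal, this is the cone over the lune of thickness \<open>D\<close> with
  normals \<open>g\<close> and \<open>S *\<^sub>R e - C *\<^sub>R g\<close>; the centres of its semicircles are \<open>e\<close> and \<open>C *\<^sub>R e + S *\<^sub>R g\<close>.
\<close>

definition lune_at :: "real \<Rightarrow> real \<Rightarrow> real^3 \<Rightarrow> real^3 \<Rightarrow> (real^3) set" where
  "lune_at C S e g = {x. 0 \<le> x \<bullet> g \<and> C * (x \<bullet> g) \<le> S * (x \<bullet> e)}"

text \<open>
  The chord from \<open>e\<close> to \<open>C *\<^sub>R e + S *\<^sub>R g\<close> joins the centres of the two semicircles of a lune around \<open>R\<close>,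
  and both centres belong to \<open>R\<close>.  It lies in the great circle with normal \<open>e \<times> g\<close>.
\<close>

definition touching_frame :: "real \<Rightarrow> real \<Rightarrow> (real^3) set \<Rightarrow> real^3 \<Rightarrow> real^3 \<Rightarrow> bool" where
  "touching_frame C S R e g \<longleftrightarrow> norm e = 1 \<and> norm g = 1 \<and> e \<bullet> g = 0 \<and>
     e \<in> R \<and> C *\<^sub>R e + S *\<^sub>R g \<in> R \<and> R \<subseteq> lune_at C S e g"

text \<open>
  Cutting a convex body by a hemisphere leaves a convex body, as long as an interior point is retained.
\<close>

lemma sconvex_body_Int_hemisphere:
  assumes R: "sconvex_body R" and v: "0 < v \<bullet> x0" "x0 \<in> sinterior R"
  shows "sconvex_body {x \<in> R. 0 \<le> v \<bullet> x}"
  unfolding sconvex_body_def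
proof (intro conjI)
  have cv: "sconvex R" and cl: "closedin (top_of_set S2) R" using R by (auto simp: sconvex_body_def)
  let ?Z = "{x \<in> R. 0 \<le> v \<bullet> x}"
  show "sconvex ?Z"
    unfolding sconvex_def
  proof (intro conjI ballI)
    show "?Z \<subseteq> S2" using cv by (auto simp: sconvex_def)
    show "- a \<notin> ?Z" if "a \<in> ?Z" for a using cv that by (auto simp: sconvex_def)
    show "sarc a b \<subseteq> ?Z" if ab: "a \<in> ?Z" "b \<in> ?Z" for a b
    proof
      fix y assume y: "y \<in> sarc a b"
      have "y \<in> R" using cv y ab unfolding sconvex_def by blast
      moreover have "0 \<le> v \<bullet> y" using y ab by (auto simp: sarc_def inner_add_right)
      ultimately show "y \<in> ?Z" by simp
    qed
  qed
  have "?Z = R \<inter> (S2 \<inter> {x. 0 \<le> v \<bullet> x})" using cv by (auto simp: sconvex_def)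
  moreover have "closedin (top_of_set S2) (S2 \<inter> {x. 0 \<le> v \<bullet> x})"
    by (rule closedin_closed_Int[OF closed_halfspace_ge])
  ultimately show "closedin (top_of_set S2) ?Z" using closedin_Int[OF cl] by simp
  obtain T where T: "norm x0 = 1" "open T" "x0 \<in> T" "S2 \<inter> T \<subseteq> R" using v(2) by (auto simp: mem_sinterior)
  have "open (T \<inter> {x. 0 < v \<bullet> x})" using T by (intro open_Int open_halfspace_gt)
  moreover have "x0 \<in> T \<inter> {x. 0 < v \<bullet> x}" using T v by simp
  moreover have "S2 \<inter> (T \<inter> {x. 0 < v \<bullet> x}) \<subseteq> ?Z" using T by auto
  ultimately have "x0 \<in> sinterior ?Z" unfolding mem_sinterior using T(1) by blast
  then show "sinterior ?Z \<noteq> {}" by blast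
qed

text \<open>
  In the application \<open>p\<close>, \<open>q\<close>, \<open>r\<close> are the values of a functional on a basis \<open>m\<close>, \<open>e\<close>, \<open>g\<close>, nonnegative on \<open>m\<close>
  and on \<open>m + e\<close> and positive on \<open>g\<close>; it vanishes at a point close to \<open>m\<close> and is negative at a point close to \<open>e\<close>,
  both on the nonnegative side of the plane spanned by \<open>m\<close> and \<open>e\<close>.
  Roughly, \<open>0 \<ge> p\<close> by the first point and \<open>0 > q\<close> by the second, which contradicts \<open>p + q \<ge> 0\<close>.
\<close>

lemma nearby_coordinates_contradiction:
  fixes p q r :: real
  assumes "0 \<le> p" "0 \<le> p + q" "0 < r" and c: "0 \<le> c" "0 \<le> c'"
    and 0: "a * p + b * q + c * r = 0" and neg: "a' * p + b' * q + c' * r < 0"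
    and near: "\<bar>a - 1\<bar> \<le> 1/4" "\<bar>b\<bar> \<le> 1/4" "\<bar>a'\<bar> \<le> 1/4" "\<bar>b' - 1\<bar> \<le> 1/4"
  shows False
proof -
  have cr: "0 \<le> c * r" "0 \<le> c' * r" using assms by simp_all
  have ap: "3/4 * p \<le> a * p" "- (1/4 * p) \<le> a' * p"
  proof -
    have "3/4 \<le> a" "- (1/4) \<le> a'" using near by linarith+
    then show "3/4 * p \<le> a * p" using assms by (intro mult_right_mono) auto
    have "- (1/4) * p \<le> a' * p" using \<open>- (1/4) \<le> a'\<close> assms by (intro mult_right_mono) auto
    then show "- (1/4 * p) \<le> a' * p" by simp
  qed
  have bq: "\<bar>b * q\<bar> \<le> 1/4 * \<bar>q\<bar>" unfolding abs_mult using near by (intro mult_right_mono) auto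
  show False
  proof (cases "q \<le> 0")
    case True
    then have "p = 0" using ap bq cr 0 assms by linarith
    moreover from this have "q = 0" using True assms by simp
    ultimately show False using neg cr by simp
  next
    case False
    moreover have "3/4 \<le> b'" using near by linarith
    ultimately have "3/4 * q \<le> b' * q" by (intro mult_right_mono) auto
    then show False using ap bq cr 0 neg False by linarith
  qed
qed

text \<open>
  The functional \<open>v\<close> exposes \<open>e\<close> quantitatively, so the caps cut off by \<open>v - d n *\<^sub>R e\<close> shrink to \<open>e\<close> as \<open>d n\<close> tends
  to \<open>0\<close>.  The truncated bodies \<open>Z n\<close> are strictly thinner than \<open>R\<close>; a thinnest lune around \<open>Z n\<close> does not
  contain \<open>R\<close>, so one of its hemispheres, with centre \<open>gs n\<close> say, cuts off a point \<open>xs n\<close> close to \<open>e\<close>.  Along a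
  subsequence these lunes converge to a lune of thickness \<open>D\<close> around \<open>R\<close> with \<open>e\<close> on its boundary.

  It remains to see that the centre \<open>m\<close> of the bounding semicircle is \<open>e\<close> itself.  The centres \<open>ms n\<close> of
  the approximating semicircles belong to \<open>R\<close> and converge to \<open>m\<close>.  If \<open>m\<close> and \<open>e\<close> were different, the
  boundary circle of the \<open>n\<close>-th hemisphere would pass through \<open>ms n\<close> near \<open>m\<close> and cut off \<open>xs n\<close>
  near \<open>e\<close>, while \<open>m\<close> and the midpoint of \<open>m\<close> and \<open>e\<close> are still contained in \<open>Z n\<close> and hence in that hemisphere.
  As \<open>ms n\<close> and \<open>xs n\<close> do not lie beyond the limit circle, which carries \<open>m\<close> and \<open>e\<close>, this is impossible by
  \<open>nearby_coordinates_contradiction\<close>.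
\<close>

lemma contact_touching_frame:
  assumes R: "reduced_body R"
    and e: "e \<in> R" and v: "v \<noteq> 0" "v \<bullet> e = 0" and k: "0 < k"
    and expose: "\<And>x. x \<in> R \<Longrightarrow> k * (1 - x \<bullet> e) \<le> v \<bullet> x"
  shows "\<exists>g. touching_frame (cos (thickness R)) (sin (thickness R)) R e g"
proof -
  have body: "sconvex_body R" using R by (simp add: reduced_body_def)
  have cv: "sconvex R" using body by (simp add: sconvex_body_def)
  define C S where "C = cos (thickness R)" and "S = sin (thickness R)"
  obtain g0 h0 :: "real^3" where gh0: "\<bar>g0 \<bullet> h0\<bar> < 1" "thickness R = arccos (- (g0 \<bullet> h0))"
    and min0: "\<forall>g\<in>normals R. \<forall>h\<in>normals R. g0 \<bullet> h0 \<le> g \<bullet> h"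
    using thickness_normals[OF body] by metis
  have C_eq: "C = - (g0 \<bullet> h0)" using gh0 by (simp add: C_def)
  have t0: "0 \<le> thickness R" "thickness R \<le> pi" using gh0 by (auto intro: arccos_lbound arccos_ubound)
  have C1: "\<bar>C\<bar> < 1" using C_eq gh0 by simp
  have CS: "C\<^sup>2 + S\<^sup>2 = 1" by (simp add: C_def S_def)
  have S0: "0 < S"
  proof -
    have "S\<^sup>2 \<noteq> 0" using CS C1 by (metis abs_square_less_1 add.right_neutral less_irrefl)
    moreover have "0 \<le> S" using t0 by (simp add: S_def sin_ge_zero)
    ultimately show ?thesis by simp
  qed
  have min: "- C \<le> g \<bullet> h" if "g \<in> normals R" "h \<in> normals R" for g h
    using min0 that C_eq by simp
  have n1: "norm x = 1" if "x \<in> R" for x using sconvex_body_norm[OF body that] .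
  have vpos: "0 < v \<bullet> x" if "x \<in> R" "x \<noteq> e" for x
  proof -
    have "x \<bullet> e \<noteq> 1" using inner_eq_1_unit[of x e] n1 e that by blast
    then have "x \<bullet> e < 1" using abs_inner_le_1[of x e] n1 e that by force
    then have "0 < k * (1 - x \<bullet> e)" using k by simp
    then show ?thesis using expose[OF that(1)] by linarith
  qed
  have v_ge: "0 \<le> v \<bullet> x" if "x \<in> R" for x using vpos[OF that] v by (cases "x = e") auto
  obtain x0 where x0: "x0 \<in> sinterior R" using body by (auto simp: sconvex_body_def)
  have x0R: "x0 \<in> R" using x0 interior_of_subset[of _ R] by auto
  have vx0: "0 < v \<bullet> x0" by (rule interior_strictly_positive[OF x0 v(1) v_ge])
  have ee: "e \<bullet> e = 1" using n1[OF e] by (simp add: dot_square_norm)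
  \<comment> \<open>The factor 1/2 keeps the interior point \<open>x0\<close> inside every truncated body.\<close>
  define d where "d = (\<lambda>n. (v \<bullet> x0) / 2 * inverse (real (Suc n)))"
  have d0: "0 < d n" for n using vx0 by (simp add: d_def)
  have dx0: "d n < v \<bullet> x0" for n
  proof -
    have "(v \<bullet> x0) / 2 * inverse (real (Suc n)) \<le> (v \<bullet> x0) / 2 * 1"
      using vx0 by (intro mult_left_mono) (auto simp: inverse_le_1_iff)
    then show ?thesis using vx0 by (simp add: d_def)
  qed
  have dlim: "d \<longlonglongrightarrow> 0"
    using tendsto_mult[OF tendsto_const[of "(v \<bullet> x0) / 2"] LIMSEQ_inverse_real_of_nat] by (simp add: d_def)
  define Z where "Z = (\<lambda>n. {x \<in> R. 0 \<le> (v - d n *\<^sub>R e) \<bullet> x})"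
  have Z_body: "sconvex_body (Z n)" for n
  proof -
    have "d n * (e \<bullet> x0) \<le> d n * 1"
      using abs_inner_le_1[of e x0] n1 e x0R d0[of n] by (intro mult_left_mono) auto
    then have "0 < (v - d n *\<^sub>R e) \<bullet> x0" using dx0[of n] by (simp add: inner_diff_left)
    then show ?thesis unfolding Z_def by (rule sconvex_body_Int_hemisphere[OF body _ x0])
  qed
  have Z_thin: "thickness (Z n) < thickness R" for n
  proof -
    have "(v - d n *\<^sub>R e) \<bullet> e < 0" using v ee d0[of n] by (simp add: inner_diff_left)
    then have "e \<notin> Z n" by (simp add: Z_def)
    then have "Z n \<noteq> R" using e by blast
    moreover have "Z n \<subseteq> R" by (auto simp: Z_def)
    ultimately show ?thesis using R Z_body by (simp add: reduced_body_def)
  qed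
  have "\<exists>g h x. g \<in> normals (Z n) \<and> h \<in> normals (Z n) \<and> g \<bullet> h < - C \<and>
      sgn (h - (h \<bullet> g) *\<^sub>R g) \<in> Z n \<and> x \<in> R \<and> g \<bullet> x < 0" for n
  proof -
    obtain g h where gh: "g \<in> normals (Z n)" "h \<in> normals (Z n)" "\<bar>g \<bullet> h\<bar> < 1"
      and m: "\<forall>g'\<in>normals (Z n). \<forall>h'\<in>normals (Z n). g \<bullet> h \<le> g' \<bullet> h'"
      and th: "thickness (Z n) = arccos (- (g \<bullet> h))"
      using thickness_normals[OF Z_body] by metis
    have "arccos (- (g \<bullet> h)) < arccos (- (g0 \<bullet> h0))" using Z_thin[of n] th gh0(2) by simp
    then have lt: "g \<bullet> h < - C" using gh(3) gh0(1) C_eq by (simp add: arccos_less_mono)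
    have gh1: "norm g = 1" "norm h = 1" using gh by (auto simp: normals_def)
    have hg: "\<bar>h \<bullet> g\<bar> < 1" "h \<bullet> g < - C" using gh(3) lt by (simp_all only: inner_commute[of h g])
    have foot1: "sgn (h - (h \<bullet> g) *\<^sub>R g) \<in> Z n"
      by (rule farthest_normal_foot[OF Z_body gh(1) gh1(2) _ hg(1)]) (use m gh in \<open>metis inner_commute\<close>)
    have foot2: "sgn (g - (g \<bullet> h) *\<^sub>R h) \<in> Z n"
      by (rule farthest_normal_foot[OF Z_body gh(2) gh1(1) _ gh(3)]) (use m gh in auto)
    \<comment> \<open>Otherwise the lune would be too thin for \<open>R\<close>.\<close>
    have "g \<notin> normals R \<or> h \<notin> normals R" using min[of g h] lt by auto
    then show ?thesis
    proof
      assume "g \<notin> normals R"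
      then obtain x where "x \<in> R" "g \<bullet> x < 0" using gh1 by (auto simp: normals_def not_le)
      then show ?thesis using gh lt foot1 by blast
    next
      assume "h \<notin> normals R"
      then obtain x where "x \<in> R" "h \<bullet> x < 0" using gh1 by (auto simp: normals_def not_le)
      then show ?thesis using gh hg foot2 by blast
    qed
  qed
  then have "\<forall>n. \<exists>g h x. g \<in> normals (Z n) \<and> h \<in> normals (Z n) \<and> g \<bullet> h < - C \<and>
      sgn (h - (h \<bullet> g) *\<^sub>R g) \<in> Z n \<and> x \<in> R \<and> g \<bullet> x < 0" ..
  then obtain gs hs xs where all: "\<forall>n. gs n \<in> normals (Z n) \<and> hs n \<in> normals (Z n) \<and> gs n \<bullet> hs n < - C \<and>
      sgn (hs n - (hs n \<bullet> gs n) *\<^sub>R gs n) \<in> Z n \<and> xs n \<in> R \<and> gs n \<bullet> xs n < 0"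
    unfolding choice_iff by (elim exE)
  have seq: "gs n \<in> normals (Z n)" "hs n \<in> normals (Z n)" "gs n \<bullet> hs n < - C"
      "sgn (hs n - (hs n \<bullet> gs n) *\<^sub>R gs n) \<in> Z n" "xs n \<in> R" "gs n \<bullet> xs n < 0" for n
    using all by simp_all
  have "compact (Sigma (sphere (0::real^3) 1) (\<lambda>_. sphere (0::real^3) 1))"
    by (intro compact_Times compact_sphere)
  then have seqc: "seq_compact (Sigma (sphere (0::real^3) 1) (\<lambda>_. sphere (0::real^3) 1))"
    by (rule compact_imp_seq_compact)
  have on_spheres: "\<forall>n. (gs n, hs n) \<in> Sigma (sphere 0 1) (\<lambda>_. sphere 0 1)"
    using seq(1,2) by (auto simp: normals_def)
  obtain l r where "l \<in> Sigma (sphere (0::real^3) 1) (\<lambda>_. sphere (0::real^3) 1)"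
    and r: "strict_mono r" and "((\<lambda>n. (gs n, hs n)) \<circ> r) \<longlonglongrightarrow> l"
    by (rule seq_compactE[OF seqc on_spheres])
  then have lim': "(\<lambda>n. (gs (r n), hs (r n))) \<longlonglongrightarrow> l" by (simp add: o_def)
  define g h where "g = fst l" and "h = snd l"
  have G: "(\<lambda>n. gs (r n)) \<longlonglongrightarrow> g" and H: "(\<lambda>n. hs (r n)) \<longlonglongrightarrow> h"
    using tendsto_fst[OF lim'] tendsto_snd[OF lim'] by (simp_all add: g_def h_def)
  have dr: "(\<lambda>n. d (r n)) \<longlonglongrightarrow> 0" using LIMSEQ_subseq_LIMSEQ[OF dlim r] by (simp add: o_def)
  have xlim: "(\<lambda>n. xs (r n)) \<longlonglongrightarrow> e"
  proof -
    have bound: "(norm (xs n - e))\<^sup>2 \<le> 2 * d n / k" for n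
    proof -
      have "xs n \<notin> Z n" using seq(1)[of n] seq(6)[of n] by (force simp: normals_def)
      then have "v \<bullet> xs n < d n * (e \<bullet> xs n)" using seq(5) by (simp add: Z_def inner_diff_left)
      also have "\<dots> \<le> d n * 1"
        using abs_inner_le_1[of e "xs n"] n1 e seq(5)[of n] d0[of n] by (intro mult_left_mono) auto
      finally have "k * (1 - xs n \<bullet> e) \<le> d n" using expose[OF seq(5)[of n]] by simp
      then have "1 - xs n \<bullet> e \<le> d n / k" using k by (simp add: field_simps)
      moreover have "(norm (xs n - e))\<^sup>2 = 2 - 2 * (xs n \<bullet> e)"
        unfolding power2_norm_eq_inner inner_diff_left inner_diff_right ee inner_commute[of e "xs n"]
        using n1[OF seq(5)[of n]] by (simp add: dot_square_norm)
      ultimately show ?thesis by simp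
    qed
    have "(\<lambda>n. 2 * d (r n) / k) \<longlonglongrightarrow> 2 * 0 / k" using dr k by (intro tendsto_intros) auto
    then have up: "(\<lambda>n. 2 * d (r n) / k) \<longlonglongrightarrow> 0" by simp
    have "(\<lambda>n. (norm (xs (r n) - e))\<^sup>2) \<longlonglongrightarrow> 0"
      by (rule tendsto_sandwich[OF _ _ tendsto_const up]) (use bound in \<open>auto intro!: always_eventually\<close>)
    then have "(\<lambda>n. norm (xs (r n) - e)) \<longlonglongrightarrow> 0" using tendsto_real_sqrt[of _ 0] by fastforce
    then have "(\<lambda>n. xs (r n) - e) \<longlonglongrightarrow> 0" by (rule tendsto_norm_zero_cancel)
    then show ?thesis by (rule LIM_zero_cancel)
  qed
  have inZ: "\<forall>\<^sub>F n in sequentially. x \<in> Z (r n)" if x: "x \<in> R" "x \<noteq> e" for x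
  proof -
    have "(\<lambda>n. (v - d (r n) *\<^sub>R e) \<bullet> x) \<longlonglongrightarrow> (v - 0 *\<^sub>R e) \<bullet> x"
      by (intro tendsto_intros dr)
    then have "\<forall>\<^sub>F n in sequentially. 0 < (v - d (r n) *\<^sub>R e) \<bullet> x"
      by (rule order_tendstoD) (use vpos[OF x] in simp)
    then show ?thesis by eventually_elim (use x in \<open>auto simp: Z_def\<close>)
  qed
  have lim_normal: "y \<in> normals R" if Y: "\<And>n. ys n \<in> normals (Z (r n))" "ys \<longlonglongrightarrow> y" for ys y
  proof -
    have "(\<lambda>n. norm (ys n)) \<longlonglongrightarrow> norm y" using Y(2) by (rule tendsto_norm)
    moreover have "norm (ys n) = 1" for n using Y(1) by (simp add: normals_def)
    ultimately have y1: "norm y = 1" by (simp add: LIMSEQ_const_iff)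
    have ypos: "0 \<le> y \<bullet> x" if x: "x \<in> R" "x \<noteq> e" for x
    proof (rule tendsto_lowerbound)
      show "(\<lambda>n. ys n \<bullet> x) \<longlonglongrightarrow> y \<bullet> x" by (intro tendsto_intros Y)
      show "\<forall>\<^sub>F n in sequentially. 0 \<le> ys n \<bullet> x"
        using inZ[OF x] by eventually_elim (use Y(1) in \<open>auto simp: normals_def\<close>)
    qed simp
    \<comment> \<open>The point \<open>e\<close> itself belongs to no \<open>Z n\<close>; it is approached along the arc towards \<open>x0\<close>.\<close>
    have "0 \<le> y \<bullet> e"
    proof (rule ccontr)
      assume "\<not> ?thesis"
      then have neg: "y \<bullet> e < 0" by simp
      define s where "s = - (y \<bullet> e) / 2"
      have s: "0 < s" using neg by (simp add: s_def)
      have c: "1 *\<^sub>R e + s *\<^sub>R x0 \<noteq> 0 \<and> sgn (1 *\<^sub>R e + s *\<^sub>R x0) \<in> R"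
        by (rule sconvex_combination[OF cv e x0R]) (use s in auto)
      then have nz: "e + s *\<^sub>R x0 \<noteq> 0" and inR: "sgn (e + s *\<^sub>R x0) \<in> R" by simp_all
      have "0 < v \<bullet> (e + s *\<^sub>R x0)" using v vx0 s by (simp add: inner_add_right)
      then have "0 < v \<bullet> sgn (e + s *\<^sub>R x0)" using nz by (simp add: sgn_div_norm)
      then have "sgn (e + s *\<^sub>R x0) \<noteq> e" using v by auto
      then have "0 \<le> y \<bullet> sgn (e + s *\<^sub>R x0)" by (rule ypos[OF inR])
      then have "0 \<le> y \<bullet> (e + s *\<^sub>R x0)" using nz by (simp add: sgn_div_norm zero_le_mult_iff)
      then have "0 \<le> y \<bullet> e + s * (y \<bullet> x0)" by (simp add: inner_add_right)
      moreover have "s * (y \<bullet> x0) \<le> s * 1"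
        using abs_inner_le_1[of y x0] y1 n1[OF x0R] s by (intro mult_left_mono) auto
      ultimately show False using neg s_def by linarith
    qed
    then show ?thesis using y1 ypos by (auto simp: normals_def)
  qed
  have gR: "g \<in> normals R" and hR: "h \<in> normals R"
    using lim_normal[OF seq(1) G] lim_normal[OF seq(2) H] .
  have g1: "norm g = 1" and h1: "norm h = 1" using gR hR by (auto simp: normals_def)
  have gg: "g \<bullet> g = 1" "h \<bullet> h = 1" using g1 h1 by (simp_all add: dot_square_norm)
  have gh: "g \<bullet> h = - C"
  proof (rule antisym)
    show "- C \<le> g \<bullet> h" by (rule min[OF gR hR])
    show "g \<bullet> h \<le> - C"
      by (rule tendsto_upperbound[OF tendsto_inner[OF G H]]) (auto intro!: always_eventually less_imp_le seq(3))
  qed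
  have hg: "h \<bullet> g = - C" using gh by (simp add: inner_commute)
  have sqS: "sqrt (1 - C\<^sup>2) = S" using CS S0 by (intro real_sqrt_unique) auto
  define m where "m = sgn (h - (h \<bullet> g) *\<^sub>R g)"
  have nS: "norm (h - (h \<bullet> g) *\<^sub>R g) = S" "norm (g - (g \<bullet> h) *\<^sub>R h) = S"
    using norm_orthogonal_part[OF g1 h1] norm_orthogonal_part[OF h1 g1] unfolding gh hg
    by (simp_all add: sqS)
  have mR: "m \<in> R" unfolding m_def
    by (rule farthest_normal_foot[OF body gR h1]) (use hg C1 min[OF hR] in auto)
  have m_eq: "S *\<^sub>R m = h + C *\<^sub>R g" using S0 unfolding m_def sgn_div_norm nS by (simp add: hg)
  have fR: "sgn (g - (g \<bullet> h) *\<^sub>R h) \<in> R"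
    by (rule farthest_normal_foot[OF body hR g1]) (use gh C1 min[OF gR] in auto)
  have f_eq: "sgn (g - (g \<bullet> h) *\<^sub>R h) = C *\<^sub>R m + S *\<^sub>R g"
  proof -
    have "S *\<^sub>R (C *\<^sub>R m + S *\<^sub>R g) = C *\<^sub>R (S *\<^sub>R m) + (S\<^sup>2) *\<^sub>R g"
      by (simp add: algebra_simps power2_eq_square)
    also have "\<dots> = C *\<^sub>R h + (C\<^sup>2 + S\<^sup>2) *\<^sub>R g"
      unfolding m_eq by (simp add: algebra_simps power2_eq_square)
    also have "\<dots> = S *\<^sub>R sgn (g - (g \<bullet> h) *\<^sub>R h)"
      using S0 CS nS(2) by (simp add: sgn_div_norm gh)
    finally show ?thesis using S0 by simp
  qed
  have m1: "norm m = 1" by (rule n1[OF mR])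
  have mg: "m \<bullet> g = 0"
  proof -
    have "S * (m \<bullet> g) = 0" unfolding inner_scaleR_left[symmetric] m_eq by (simp add: inner_add_left gg hg)
    then show ?thesis using S0 by simp
  qed
  have lune: "R \<subseteq> lune_at C S m g"
  proof
    fix x assume x: "x \<in> R"
    have "S * (m \<bullet> x) = h \<bullet> x + C * (g \<bullet> x)"
      unfolding inner_scaleR_left[symmetric] m_eq by (simp add: inner_add_left)
    then show "x \<in> lune_at C S m g" using x gR hR
      by (auto simp: lune_at_def normals_def inner_commute)
  qed
  have frame: "touching_frame C S R m g"
    unfolding touching_frame_def using m1 g1 mg mR fR f_eq lune by simp
  have "m = e"
  proof (rule ccontr)
    assume me: "m \<noteq> e"
    define ms where "ms = (\<lambda>n. sgn (hs n - (hs n \<bullet> gs n) *\<^sub>R gs n))"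
    have mlim: "(\<lambda>n. ms (r n)) \<longlonglongrightarrow> m"
      unfolding ms_def m_def
    proof (intro tendsto_intros G H)
      show "h - (h \<bullet> g) *\<^sub>R g \<noteq> 0" using nS S0 by auto
    qed
    have ge: "g \<bullet> e = 0"
    proof (rule antisym)
      show "g \<bullet> e \<le> 0"
        by (rule tendsto_upperbound[OF tendsto_inner[OF G xlim]]) (auto intro!: always_eventually less_imp_le seq(6))
      show "0 \<le> g \<bullet> e" using gR e by (simp add: normals_def)
    qed
    define w where "w = m \<times> g"
    have exp: "x = (x \<bullet> m) *\<^sub>R m + (x \<bullet> g) *\<^sub>R g + (x \<bullet> w) *\<^sub>R w" for x
      unfolding w_def by (rule orthonormal_expansion[OF m1 g1 mg])
    have e_eq: "e = (e \<bullet> m) *\<^sub>R m + (e \<bullet> w) *\<^sub>R w" using exp[of e] ge by (simp add: inner_commute)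
    have ew: "e \<bullet> w \<noteq> 0"
    proof
      assume "e \<bullet> w = 0"
      then have e_eq': "e = (e \<bullet> m) *\<^sub>R m" using e_eq by simp
      then have "\<bar>e \<bullet> m\<bar> = 1" using n1[OF e] m1 by (metis mult.right_neutral norm_scaleR)
      then have "e \<bullet> m = 1 \<or> e \<bullet> m = -1" by linarith
      then have "e = m \<or> e = - m" using e_eq' by (metis scaleR_minus1_left scaleR_one)
      then show False using me e mR cv by (auto simp: sconvex_def)
    qed
    \<comment> \<open>Coordinates with respect to the basis \<open>m\<close>, \<open>e\<close>, \<open>g\<close>.\<close>
    define B A where "B = (\<lambda>x. (x \<bullet> w) / (e \<bullet> w))" and "A = (\<lambda>x. x \<bullet> m - (e \<bullet> m) * B x)"
    have coord: "y \<bullet> x = A x * (y \<bullet> m) + B x * (y \<bullet> e) + (x \<bullet> g) * (y \<bullet> g)" for x y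
    proof -
      have 1: "y \<bullet> x = (x \<bullet> m) * (y \<bullet> m) + (x \<bullet> g) * (y \<bullet> g) + (x \<bullet> w) * (y \<bullet> w)"
        by (subst exp[of x]) (simp add: inner_add_right)
      have 2: "y \<bullet> e = (e \<bullet> m) * (y \<bullet> m) + (e \<bullet> w) * (y \<bullet> w)"
        by (subst e_eq) (simp add: inner_add_right)
      have "B x * (y \<bullet> e) = (e \<bullet> m) * B x * (y \<bullet> m) + (x \<bullet> w) * (y \<bullet> w)"
        unfolding 2 using ew by (simp add: B_def field_simps)
      then show ?thesis unfolding 1 A_def by (simp add: algebra_simps)
    qed
    have mw: "m \<bullet> w = 0" by (simp add: w_def dot_cross_self)
    have mm: "m \<bullet> m = 1" using m1 by (simp add: dot_square_norm)
    have AB: "A m = 1" "B m = 0" "A e = 0" "B e = 1"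
      using mw mm ew by (simp_all add: A_def B_def)
    have Alim: "(\<lambda>n. A (ys n)) \<longlonglongrightarrow> A y" and Blim: "(\<lambda>n. B (ys n)) \<longlonglongrightarrow> B y" if "ys \<longlonglongrightarrow> y" for ys y
      unfolding A_def B_def using ew by (intro tendsto_intros that; simp)+
    have near: "\<forall>\<^sub>F n in sequentially. \<bar>f n - a\<bar> \<le> 1/4" if "f \<longlonglongrightarrow> a" for f and a :: real
    proof -
      have "\<forall>\<^sub>F n in sequentially. dist (f n) a < 1/4" using that by (rule tendstoD) simp
      then show ?thesis by eventually_elim (simp add: dist_real_def)
    qed
    have me_c: "1 *\<^sub>R e + 1 *\<^sub>R m \<noteq> 0 \<and> sgn (1 *\<^sub>R e + 1 *\<^sub>R m) \<in> R"
      by (rule sconvex_combination[OF cv e mR]) auto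
    then have mid: "e + m \<noteq> 0" "sgn (e + m) \<in> R" by simp_all
    have "0 < v \<bullet> (e + m)" using vpos[OF mR me] v by (simp add: inner_add_right)
    then have "0 < v \<bullet> sgn (e + m)" using mid by (simp add: sgn_div_norm)
    then have mide: "sgn (e + m) \<noteq> e" using v by auto
    have "(\<lambda>n. gs (r n) \<bullet> g) \<longlonglongrightarrow> g \<bullet> g" by (intro tendsto_intros G)
    then have "\<forall>\<^sub>F n in sequentially. 0 < gs (r n) \<bullet> g" by (rule order_tendstoD) (simp add: gg)
    then have "\<forall>\<^sub>F n in sequentially. 0 < gs (r n) \<bullet> g \<and> m \<in> Z (r n) \<and> sgn (e + m) \<in> Z (r n) \<and>
        \<bar>A (ms (r n)) - 1\<bar> \<le> 1/4 \<and> \<bar>B (ms (r n)) - 0\<bar> \<le> 1/4 \<and>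
        \<bar>A (xs (r n)) - 0\<bar> \<le> 1/4 \<and> \<bar>B (xs (r n)) - 1\<bar> \<le> 1/4"
      using inZ[OF mR me] inZ[OF mid(2) mide] near[OF Alim[OF mlim]] near[OF Blim[OF mlim]]
        near[OF Alim[OF xlim]] near[OF Blim[OF xlim]] unfolding AB
      by eventually_elim simp
    then have "\<exists>n. 0 < gs (r n) \<bullet> g \<and> m \<in> Z (r n) \<and> sgn (e + m) \<in> Z (r n) \<and>
        \<bar>A (ms (r n)) - 1\<bar> \<le> 1/4 \<and> \<bar>B (ms (r n)) - 0\<bar> \<le> 1/4 \<and>
        \<bar>A (xs (r n)) - 0\<bar> \<le> 1/4 \<and> \<bar>B (xs (r n)) - 1\<bar> \<le> 1/4"
      by (rule eventually_happens'[OF sequentially_bot])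
    then obtain n where close: "0 < gs (r n) \<bullet> g \<and> m \<in> Z (r n) \<and> sgn (e + m) \<in> Z (r n) \<and>
        \<bar>A (ms (r n)) - 1\<bar> \<le> 1/4 \<and> \<bar>B (ms (r n)) - 0\<bar> \<le> 1/4 \<and>
        \<bar>A (xs (r n)) - 0\<bar> \<le> 1/4 \<and> \<bar>B (xs (r n)) - 1\<bar> \<le> 1/4" by (elim exE)
    then have N: "0 < gs (r n) \<bullet> g" "m \<in> Z (r n)" "sgn (e + m) \<in> Z (r n)"
        "\<bar>A (ms (r n)) - 1\<bar> \<le> 1/4" "\<bar>B (ms (r n))\<bar> \<le> 1/4"
        "\<bar>A (xs (r n))\<bar> \<le> 1/4" "\<bar>B (xs (r n)) - 1\<bar> \<le> 1/4"
      by simp_all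
    let ?G = "gs (r n)"
    have GZ: "0 \<le> ?G \<bullet> x" if "x \<in> Z (r n)" for x using seq(1)[of "r n"] that by (simp add: normals_def)
    have gpos: "0 \<le> x \<bullet> g" if "x \<in> R" for x
    proof -
      have "0 \<le> g \<bullet> x" using gR that by (simp add: normals_def)
      then show ?thesis by (simp add: inner_commute)
    qed
    have GG: "?G \<bullet> ?G = 1" using seq(1)[of "r n"] by (simp add: normals_def dot_square_norm)
    show False
    proof (rule nearby_coordinates_contradiction[OF _ _ N(1)])
      show "0 \<le> ?G \<bullet> m" by (rule GZ[OF N(2)])
      have "0 \<le> ?G \<bullet> sgn (e + m)" by (rule GZ[OF N(3)])
      then have "0 \<le> ?G \<bullet> (e + m)" using mid by (simp add: sgn_div_norm zero_le_mult_iff)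
      then show "0 \<le> ?G \<bullet> m + ?G \<bullet> e" by (simp add: inner_add_right)
      have "ms (r n) \<in> R" using seq(4)[of "r n"] by (simp add: ms_def Z_def)
      then show "0 \<le> ms (r n) \<bullet> g" by (rule gpos)
      show "0 \<le> xs (r n) \<bullet> g" by (rule gpos[OF seq(5)])
      have "?G \<bullet> ms (r n) = 0" unfolding ms_def sgn_div_norm
        by (simp add: inner_diff_right GG inner_commute)
      then show "A (ms (r n)) * (?G \<bullet> m) + B (ms (r n)) * (?G \<bullet> e) + (ms (r n) \<bullet> g) * (?G \<bullet> g) = 0"
        by (simp only: coord[symmetric])
      show "A (xs (r n)) * (?G \<bullet> m) + B (xs (r n)) * (?G \<bullet> e) + (xs (r n) \<bullet> g) * (?G \<bullet> g) < 0"
        using seq(6) by (simp only: coord[symmetric])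
    qed (rule N)+
  qed
  then show ?thesis using frame by (auto simp: C_def S_def)
qed

section \<open>Chords of touching lunes cross\<close>

text \<open>
  Interchanging the two semicircles replaces the frame \<open>e\<close>, \<open>g\<close> by the one below.
\<close>

lemma lune_at_swap:
  assumes "C\<^sup>2 + S\<^sup>2 = 1" 
  shows "lune_at C S (C *\<^sub>R e + S *\<^sub>R g) (S *\<^sub>R e - C *\<^sub>R g) = lune_at C S e g"
proof -
  have "S * (C * p + S * r) - C * (S * p - C * r) = r" for p r
  proof -
    have "S * (C * p + S * r) - C * (S * p - C * r) = (C\<^sup>2 + S\<^sup>2) * r"
      by (simp add: power2_eq_square algebra_simps)
    then show ?thesis using assms by simp
  qed
  then have "C * (S * p - C * r) \<le> S * (C * p + S * r) \<longleftrightarrow> 0 \<le> r" for p r :: real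
    by (metis diff_ge_0_iff_ge)
  then show ?thesis
    by (auto simp: lune_at_def inner_add_right inner_diff_right)
qed

text \<open>
  Two great circles meet at an angle with cosine \<open>k\<close>.  On the first an arc of length \<open>D\<close> starts at angle
  \<open>(c1, s1)\<close>, an acute angle from a common point, and stays in the open half circle; on the second an arc of length
  \<open>D\<close> starts at \<open>(c2, s2)\<close>.  Orthogonal projection between the circles moves a point at acute angle strictly
  towards the common point.  The hypotheses \<open>g\<close> and \<open>g2\<close> state that the projection of each starting point is not
  nearer to the common point than the other starting point; so both arcs cannot project into each other.
  The hypotheses \<open>h\<close>, \<open>g'\<close> and \<open>h'\<close> place the second arc on the correct half of its circle.
\<close>

lemma no_nested_arcs:
  fixes C S k c1 s1 c2 s2 :: real
  assumes CS: "0 < S" "C\<^sup>2 + S\<^sup>2 = 1" and k: "0 \<le> k" "k\<^sup>2 < 1"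
    and unit1: "c1\<^sup>2 + s1\<^sup>2 = 1" and unit2: "c2\<^sup>2 + s2\<^sup>2 = 1"
    and pos: "0 < c1" "0 < s1" "0 < S * c1 + C * s1"
    and g: "0 \<le> k * (c1 * s2) - s1 * c2"
    and h: "0 \<le> (S * c1 + C * s1) * c2 + k * ((S * s1 - C * c1) * s2)"
    and g': "0 \<le> k * (c1 * (C * s2 + S * c2)) - s1 * (C * c2 - S * s2)"
    and h': "0 \<le> (S * c1 + C * s1) * (C * c2 - S * s2) + k * ((S * s1 - C * c1) * (C * s2 + S * c2))"
    and g2: "0 \<le> k * (c2 * s1) - s2 * c1"
  shows False
proof (cases "k = 0")
  case True
  have c2: "c2 = 0" 
  proof -
    have "s1 * c2 \<le> 0" "0 \<le> (S * c1 + C * s1) * c2" using g h True by simp_all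
    then show ?thesis using pos by (smt (verit) mult_pos_pos mult_pos_neg)
  qed
  have "C * c2 - S * s2 = 0"
  proof -
    have "s1 * (C * c2 - S * s2) \<le> 0" "0 \<le> (S * c1 + C * s1) * (C * c2 - S * s2)" using g' h' True by simp_all
    then show ?thesis using pos by (smt (verit) mult_pos_pos mult_pos_neg)
  qed
  then show False using c2 CS unit2 by simp
next
  case False
  then have k0: "0 < k" using k by simp
  have "0 \<le> (S * c1 + C * s1) * (k * (c1 * s2) - s1 * c2)
      + s1 * ((S * c1 + C * s1) * c2 + k * ((S * s1 - C * c1) * s2))"
    using mult_nonneg_nonneg[OF less_imp_le[OF pos(3)] g] mult_nonneg_nonneg[OF less_imp_le[OF pos(2)] h]
    by (rule add_nonneg_nonneg)
  also have "\<dots> = k * S * s2 * (c1\<^sup>2 + s1\<^sup>2)" by (simp add: power2_eq_square algebra_simps)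
  finally have "0 \<le> (k * S) * s2" using unit1 by simp
  moreover have "0 < k * S" using k0 CS by simp
  ultimately have "0 \<le> s2" by (simp add: zero_le_mult_iff)
  show False
  proof (cases "s2 = 0")
    case True
    then have "0 \<le> k * s1 * c2" "s1 * c2 \<le> 0" using g2 g by (simp_all add: algebra_simps)
    then have "c2 = 0" using k0 pos by (smt (verit) mult_pos_pos mult_pos_neg)
    then show False using True unit2 by simp
  next
    case False
    then have s2: "0 < s2" using \<open>0 \<le> s2\<close> by simp
    have "0 \<le> k * (k * (c1 * s2) - s1 * c2) + (k * (c2 * s1) - s2 * c1)"
      using g g2 k by simp
    also have "\<dots> = (k\<^sup>2 - 1) * (c1 * s2)" by (simp add: power2_eq_square algebra_simps)
    finally show False using k s2 pos by (smt (verit) mult_neg_pos mult_pos_pos)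
  qed
qed

text \<open>
  Up to exchanging its two ends, a chord in the plane of \<open>p\<close> and \<open>T\<close> runs in the direction from \<open>p\<close> to \<open>T\<close>.
\<close>

lemma orient_arc:
  assumes CS: "C\<^sup>2 + S\<^sup>2 = 1"
    and pT: "norm p = 1" "norm T = 1" "p \<bullet> T = 0"
    and e: "e = ec *\<^sub>R p + es *\<^sub>R T" and g: "g = gc *\<^sub>R p + gs *\<^sub>R T"
    and eg: "norm e = 1" "norm g = 1" "e \<bullet> g = 0"
  obtains a b where "(a, b) = (e, g) \<or> (a, b) = (C *\<^sub>R e + S *\<^sub>R g, S *\<^sub>R e - C *\<^sub>R g)"
    and "a = (a \<bullet> p) *\<^sub>R p + (a \<bullet> T) *\<^sub>R T" "b = (a \<bullet> p) *\<^sub>R T - (a \<bullet> T) *\<^sub>R p"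
    and "(a \<bullet> p)\<^sup>2 + (a \<bullet> T)\<^sup>2 = 1"
proof -
  have pp: "p \<bullet> p = 1" "T \<bullet> T = 1" using pT by (simp_all add: dot_square_norm)
  have ec: "ec\<^sup>2 + es\<^sup>2 = 1" "gc\<^sup>2 + gs\<^sup>2 = 1" "ec * gc + es * gs = 0"
    using eg pp pT(3) unfolding norm_eq_1 e g
    by (simp_all add: inner_add_left inner_add_right inner_commute power2_eq_square algebra_simps)
  have "(gc, gs) = (-es, ec) \<or> (gc, gs) = (es, -ec)"
  proof -
    have "gs = ec * (ec * gs - es * gc)" "gc = - es * (ec * gs - es * gc)"
    proof -
      have "gs * (ec\<^sup>2 + es\<^sup>2) = ec * (ec * gs - es * gc) + es * (ec * gc + es * gs)"
        "gc * (ec\<^sup>2 + es\<^sup>2) = - es * (ec * gs - es * gc) + ec * (ec * gc + es * gs)"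
        by (simp_all add: power2_eq_square algebra_simps)
      then show "gs = ec * (ec * gs - es * gc)" "gc = - es * (ec * gs - es * gc)" using ec by simp_all
    qed
    moreover have "ec * gs - es * gc = 1 \<or> ec * gs - es * gc = - 1"
    proof -
      have "(ec * gs - es * gc)\<^sup>2 + (ec * gc + es * gs)\<^sup>2 = (ec\<^sup>2 + es\<^sup>2) * (gc\<^sup>2 + gs\<^sup>2)"
        by (simp add: power2_eq_square algebra_simps)
      then have "(ec * gs - es * gc)\<^sup>2 = 1" using ec by simp
      then show ?thesis by (simp add: power2_eq_1_iff)
    qed
    ultimately show ?thesis by auto
  qed
  then show thesis
  proof
    assume "(gc, gs) = (-es, ec)"
    then have gv: "gc = - es" "gs = ec" by auto
    have ip: "e \<bullet> p = ec" "e \<bullet> T = es"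
      using pp pT(3) by (simp_all add: e inner_add_left inner_add_right inner_commute)
    show thesis
    proof (rule that[of e g])
      show "e = (e \<bullet> p) *\<^sub>R p + (e \<bullet> T) *\<^sub>R T" unfolding ip by (rule e)
      show "g = (e \<bullet> p) *\<^sub>R T - (e \<bullet> T) *\<^sub>R p" unfolding ip g gv by simp
      show "(e \<bullet> p)\<^sup>2 + (e \<bullet> T)\<^sup>2 = 1" unfolding ip by (rule ec)
    qed simp
  next
    assume "(gc, gs) = (es, -ec)"
    then have gv: "gc = es" "gs = - ec" by auto
    let ?a = "C *\<^sub>R e + S *\<^sub>R g" and ?b = "S *\<^sub>R e - C *\<^sub>R g"
    have a_eq: "?a = (C * ec + S * es) *\<^sub>R p + (C * es - S * ec) *\<^sub>R T"
      unfolding e g gv by (simp add: algebra_simps)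
    have ip: "?a \<bullet> p = C * ec + S * es" "?a \<bullet> T = C * es - S * ec"
      unfolding a_eq using pp pT(3) by (simp_all add: inner_add_left inner_add_right inner_commute)
    show thesis
    proof (rule that[of ?a ?b])
      show "?a = (?a \<bullet> p) *\<^sub>R p + (?a \<bullet> T) *\<^sub>R T" unfolding ip by (rule a_eq)
      show "?b = (?a \<bullet> p) *\<^sub>R T - (?a \<bullet> T) *\<^sub>R p"
        unfolding ip unfolding e g gv by (simp add: algebra_simps)
      have "(C * ec + S * es)\<^sup>2 + (C * es - S * ec)\<^sup>2 = (C\<^sup>2 + S\<^sup>2) * (ec\<^sup>2 + es\<^sup>2)"
        by (simp add: power2_eq_square algebra_simps)
      then show "(?a \<bullet> p)\<^sup>2 + (?a \<bullet> T)\<^sup>2 = 1" unfolding ip using CS ec by simp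
    qed simp
  qed
qed

text \<open>
  If both ends of the first chord lie strictly on one side of the great circle of the second, the chord avoids
  the common points \<open>p\<close> and \<open>- p\<close> of the two great circles.  Choosing the sign of \<open>p\<close> and the labels of
  the ends, it starts at an acute angle from \<open>p\<close>, and \<open>no_nested_arcs\<close> applies.
\<close>

lemma arcs_cross:
  fixes e g e' g' :: "real^3"
  assumes C: "0 \<le> C" and CS: "0 < S" "C\<^sup>2 + S\<^sup>2 = 1"
    and eg: "norm e = 1" "norm g = 1" "e \<bullet> g = 0"
    and eg': "norm e' = 1" "norm g' = 1" "e' \<bullet> g' = 0"
    and in': "e \<in> lune_at C S e' g'" "C *\<^sub>R e + S *\<^sub>R g \<in> lune_at C S e' g'"
    and inn: "e' \<in> lune_at C S e g" "C *\<^sub>R e' + S *\<^sub>R g' \<in> lune_at C S e g"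
  shows "((e' \<times> g') \<bullet> e) * ((e' \<times> g') \<bullet> (C *\<^sub>R e + S *\<^sub>R g)) \<le> 0"
proof (rule ccontr)
  define n n' f where "n = e \<times> g" and "n' = e' \<times> g'" and "f = C *\<^sub>R e + S *\<^sub>R g"
  assume "\<not> ?thesis"
  then have pos: "0 < (n' \<bullet> e) * (n' \<bullet> f)" by (simp add: n'_def f_def)
  have n1: "norm n = 1" "norm n' = 1"
    unfolding n_def n'_def using eg eg' by (auto intro: norm_cross_orthonormal)
  have perp: "e \<bullet> n = 0" "g \<bullet> n = 0" "e' \<bullet> n' = 0" "g' \<bullet> n' = 0"
    by (simp_all add: n_def n'_def dot_cross_self)
  have "n \<times> n' \<noteq> 0"
  proof
    assume "n \<times> n' = 0"
    then have "e \<times> (n \<times> n') = 0" by simp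
    then have "(e \<bullet> n') *\<^sub>R n = 0" using perp by (simp add: Lagrange)
    then show False using n1 pos by (auto simp: inner_commute)
  qed
  \<comment> \<open>The directions \<open>T\<close> and \<open>T'\<close> of the two great circles at \<open>p\<close> are chosen with the chord at \<open>e\<close> on the
    side of \<open>T\<close> and with \<open>T \<bullet> T' \<ge> 0\<close>.\<close>
  define p where "p = sgn (n \<times> n')"
  have p1: "norm p = 1" using \<open>n \<times> n' \<noteq> 0\<close> by (simp add: p_def norm_sgn)
  have pn: "p \<bullet> n = 0" "p \<bullet> n' = 0"
    by (simp_all add: p_def sgn_div_norm inner_commute dot_cross_self)
  have exp: "x = (x \<bullet> p) *\<^sub>R p + (x \<bullet> (n \<times> p)) *\<^sub>R (n \<times> p)" if "x \<bullet> n = 0" for x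
    using in_plane_expansion[OF p1 n1(1) pn(1) that] .
  have exp': "x = (x \<bullet> p) *\<^sub>R p + (x \<bullet> (n' \<times> p)) *\<^sub>R (n' \<times> p)" if "x \<bullet> n' = 0" for x
    using in_plane_expansion[OF p1 n1(2) pn(2) that] .
  have fn: "f \<bullet> n = 0" using perp by (simp add: f_def inner_add_left)
  define T0 where "T0 = n \<times> p"
  have T0: "norm T0 = 1" "p \<bullet> T0 = 0"
    unfolding T0_def using p1 n1 pn by (auto intro!: norm_cross_orthonormal simp: dot_cross_self inner_commute)
  have n'x: "n' \<bullet> x = (x \<bullet> T0) * (n' \<bullet> T0)" if "x \<bullet> n = 0" for x
  proof -
    have "n' \<bullet> x = n' \<bullet> ((x \<bullet> p) *\<^sub>R p + (x \<bullet> T0) *\<^sub>R T0)"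
      using exp[OF that] by (simp add: T0_def)
    then show ?thesis using pn by (simp add: inner_add_right inner_commute)
  qed
  have "0 < ((e \<bullet> T0) * (f \<bullet> T0)) * (n' \<bullet> T0)\<^sup>2"
    using pos n'x[OF perp(1)] n'x[OF fn] by (simp add: power2_eq_square algebra_simps)
  then have same: "0 < (e \<bullet> T0) * (f \<bullet> T0)" and n'T0: "n' \<bullet> T0 \<noteq> 0"
    by (auto simp: zero_less_mult_iff)
  define T where "T = (if 0 < e \<bullet> T0 then T0 else - T0)"
  have T: "norm T = 1" "p \<bullet> T = 0" "n' \<bullet> T \<noteq> 0" and Tpos: "0 < e \<bullet> T" "0 < f \<bullet> T"
    using T0 n'T0 same by (auto simp: T_def zero_less_mult_iff)
  have expT: "x = (x \<bullet> p) *\<^sub>R p + (x \<bullet> T) *\<^sub>R T" if "x \<bullet> n = 0" for x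
    using exp[OF that] by (simp add: T_def T0_def)
  define T1 where "T1 = n' \<times> p"
  have T1: "norm T1 = 1" "p \<bullet> T1 = 0" "n' \<bullet> T1 = 0"
    unfolding T1_def using p1 n1 pn by (auto intro!: norm_cross_orthonormal simp: dot_cross_self inner_commute)
  define T' where "T' = (if 0 \<le> T \<bullet> T1 then T1 else - T1)"
  have T': "norm T' = 1" "p \<bullet> T' = 0" "n' \<bullet> T' = 0" and k0: "0 \<le> T \<bullet> T'"
    using T1 by (auto simp: T'_def)
  have expT': "x = (x \<bullet> p) *\<^sub>R p + (x \<bullet> T') *\<^sub>R T'" if "x \<bullet> n' = 0" for x
    using exp'[OF that] by (simp add: T'_def T1_def)
  have k1: "(T \<bullet> T')\<^sup>2 < 1"
  proof -
    have "T \<bullet> T = (T \<bullet> n')\<^sup>2 + (T \<bullet> T')\<^sup>2 + (T \<bullet> (n' \<times> T'))\<^sup>2"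
      using orthonormal_norm_square[of n' T' T] n1 T' by simp
    moreover have "T \<bullet> T = 1" using T by (simp add: dot_square_norm)
    moreover have "0 < (T \<bullet> n')\<^sup>2" using T(3) by (simp add: inner_commute)
    ultimately show ?thesis using zero_le_power2[of "T \<bullet> (n' \<times> T')"] by linarith
  qed
  obtain a b where ab: "(a, b) = (e, g) \<or> (a, b) = (f, S *\<^sub>R e - C *\<^sub>R g)"
    and a: "a = (a \<bullet> p) *\<^sub>R p + (a \<bullet> T) *\<^sub>R T" and b: "b = (a \<bullet> p) *\<^sub>R T - (a \<bullet> T) *\<^sub>R p"
    and a_unit: "(a \<bullet> p)\<^sup>2 + (a \<bullet> T)\<^sup>2 = 1"
    using orient_arc[OF CS(2) p1 T(1,2) expT[OF perp(1)] expT[OF perp(2)] eg] unfolding f_def by metis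
  have swap: "C *\<^sub>R (C *\<^sub>R x + S *\<^sub>R y) + S *\<^sub>R (S *\<^sub>R x - C *\<^sub>R y) = x" for x y :: "real^3"
  proof -
    have "C *\<^sub>R (C *\<^sub>R x + S *\<^sub>R y) + S *\<^sub>R (S *\<^sub>R x - C *\<^sub>R y) = (C\<^sup>2 + S\<^sup>2) *\<^sub>R x"
      by (simp add: algebra_simps power2_eq_square)
    then show ?thesis using CS by simp
  qed
  have lune_ab: "lune_at C S a b = lune_at C S e g"
    and ends_ab: "(a = e \<and> C *\<^sub>R a + S *\<^sub>R b = f) \<or> (a = f \<and> C *\<^sub>R a + S *\<^sub>R b = e)"
    using ab lune_at_swap[OF CS(2), of e g] swap[of e g] by (auto simp: f_def)
  obtain P A B where P: "P = p \<or> P = - p"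
    and A: "A = (A \<bullet> P) *\<^sub>R P + (A \<bullet> T) *\<^sub>R T" and B: "B = (A \<bullet> P) *\<^sub>R T - (A \<bullet> T) *\<^sub>R P"
    and A_unit: "(A \<bullet> P)\<^sup>2 + (A \<bullet> T)\<^sup>2 = 1"
    and AP: "0 < A \<bullet> P" "0 < A \<bullet> T" "0 < (C *\<^sub>R A + S *\<^sub>R B) \<bullet> T"
    and lune_AB: "lune_at C S A B = lune_at C S e g"
    and A_in: "A \<in> lune_at C S e' g'"
  proof (cases "0 < a \<bullet> p")
    case True
    show thesis
    proof (rule that[of p a b])
      show "0 < a \<bullet> T" "0 < (C *\<^sub>R a + S *\<^sub>R b) \<bullet> T" using ends_ab Tpos by auto
      show "a \<in> lune_at C S e' g'" using ends_ab in' by (auto simp: f_def)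
    qed (use True a b a_unit lune_ab in auto)
  next
    case False
    \<comment> \<open>Seen from \<open>- p\<close>, the other end of the chord is at an acute angle.\<close>
    let ?a = "C *\<^sub>R a + S *\<^sub>R b" and ?b = "S *\<^sub>R a - C *\<^sub>R b"
    have aT: "0 < a \<bullet> T" using ends_ab Tpos by auto
    define al ta where "al = a \<bullet> p" and "ta = a \<bullet> T"
    have al: "al \<le> 0" and ta: "0 < ta" using False aT by (simp_all add: al_def ta_def)
    have a_eq: "?a = (C * al - S * ta) *\<^sub>R p + (C * ta + S * al) *\<^sub>R T"
      "?b = (C * ta + S * al) *\<^sub>R p - (C * al - S * ta) *\<^sub>R T"
      by (subst (1) a, subst b, simp add: al_def ta_def algebra_simps)+
    have pp: "p \<bullet> p = 1" "T \<bullet> T = 1" using p1 T by (simp_all add: dot_square_norm)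
    have ip: "?a \<bullet> p = C * al - S * ta" "?a \<bullet> T = C * ta + S * al"
      unfolding a_eq using pp T by (simp_all add: inner_add_left inner_add_right inner_commute)
    have "C * al \<le> 0" "0 < S * ta" using C al CS ta by (simp_all add: mult_nonneg_nonpos)
    then have neg: "?a \<bullet> p < 0" unfolding ip by linarith
    have ab2: "?a = (?a \<bullet> p) *\<^sub>R p + (?a \<bullet> T) *\<^sub>R T" "?b = - ((?a \<bullet> p) *\<^sub>R T) + (?a \<bullet> T) *\<^sub>R p"
      unfolding ip using a_eq by (simp_all add: algebra_simps)
    have "(?a \<bullet> p)\<^sup>2 + (?a \<bullet> T)\<^sup>2 = (C\<^sup>2 + S\<^sup>2) * (al\<^sup>2 + ta\<^sup>2)"
      unfolding ip by (simp add: power2_eq_square algebra_simps)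
    then have unit: "(?a \<bullet> p)\<^sup>2 + (?a \<bullet> T)\<^sup>2 = 1" using CS a_unit by (simp add: al_def ta_def)
    show thesis
    proof (rule that[of "- p" ?a ?b])
      show "?a = (?a \<bullet> (-p)) *\<^sub>R (-p) + (?a \<bullet> T) *\<^sub>R T" using ab2 by simp
      show "?b = (?a \<bullet> (-p)) *\<^sub>R T - (?a \<bullet> T) *\<^sub>R (-p)" using ab2 by simp
      show "0 < ?a \<bullet> (-p)" using neg by simp
      show "(?a \<bullet> (-p))\<^sup>2 + (?a \<bullet> T)\<^sup>2 = 1" using unit by simp
      show "0 < ?a \<bullet> T" using ends_ab Tpos by auto
      show "0 < (C *\<^sub>R ?a + S *\<^sub>R ?b) \<bullet> T" using aT by (simp only: swap)
      show "lune_at C S ?a ?b = lune_at C S e g" using lune_ab lune_at_swap[OF CS(2)] by simp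
      show "?a \<in> lune_at C S e' g'" using ends_ab in' by (auto simp: f_def)
    qed simp
  qed
  have P1: "norm P = 1" "P \<bullet> T = 0" "P \<bullet> T' = 0" using P p1 T T' by auto
  have expP: "x = (x \<bullet> P) *\<^sub>R P + (x \<bullet> T') *\<^sub>R T'" if "x \<bullet> n' = 0" for x
    using expT'[OF that] P by auto
  define f' where "f' = C *\<^sub>R e' + S *\<^sub>R g'"
  obtain a' b' where ab': "(a', b') = (e', g') \<or> (a', b') = (f', S *\<^sub>R e' - C *\<^sub>R g')"
    and a': "a' = (a' \<bullet> P) *\<^sub>R P + (a' \<bullet> T') *\<^sub>R T'" and b': "b' = (a' \<bullet> P) *\<^sub>R T' - (a' \<bullet> T') *\<^sub>R P"
    and a'_unit: "(a' \<bullet> P)\<^sup>2 + (a' \<bullet> T')\<^sup>2 = 1"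
    using orient_arc[OF CS(2) P1(1) T'(1) P1(3) expP[OF perp(3)] expP[OF perp(4)] eg'] unfolding f'_def by metis
  have lune_ab': "lune_at C S a' b' = lune_at C S e' g'"
    using ab' lune_at_swap[OF CS(2), of e' g'] by (auto simp: f'_def)
  have "(a' = e' \<and> C *\<^sub>R a' + S *\<^sub>R b' = f') \<or> (a' = f' \<and> C *\<^sub>R a' + S *\<^sub>R b' = e')"
    using ab' swap[of e' g'] by (auto simp: f'_def)
  then have a'_in: "a' \<in> lune_at C S A B" "C *\<^sub>R a' + S *\<^sub>R b' \<in> lune_at C S A B"
    using inn unfolding lune_AB f'_def by auto
  have A_in': "A \<in> lune_at C S a' b'" using A_in lune_ab' by simp
  define c1 s1 c2 s2 where "c1 = A \<bullet> P" and "s1 = A \<bullet> T" and "c2 = a' \<bullet> P" and "s2 = a' \<bullet> T'"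
  have PP: "P \<bullet> P = 1" "T \<bullet> T = 1" "T' \<bullet> T' = 1" using P1 T T' by (simp_all add: dot_square_norm)
  have Aeq: "A = c1 *\<^sub>R P + s1 *\<^sub>R T" "B = c1 *\<^sub>R T - s1 *\<^sub>R P"
    and a'eq: "a' = c2 *\<^sub>R P + s2 *\<^sub>R T'" "b' = c2 *\<^sub>R T' - s2 *\<^sub>R P"
    using A B a' b' by (simp_all add: c1_def s1_def c2_def s2_def)
  note ips = inner_add_left inner_add_right inner_diff_left inner_diff_right inner_commute PP P1
  show False
  proof (rule no_nested_arcs[OF CS k0 k1])
    show "c1\<^sup>2 + s1\<^sup>2 = 1" "c2\<^sup>2 + s2\<^sup>2 = 1"
      using A_unit a'_unit by (simp_all add: c1_def s1_def c2_def s2_def)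
    show "0 < c1" "0 < s1" using AP by (simp_all add: c1_def s1_def)
    show "0 < S * c1 + C * s1" using AP(3) P1 PP unfolding Aeq
      by (simp add: ips algebra_simps)
    show "0 \<le> (T \<bullet> T') * (c1 * s2) - s1 * c2" 
      using a'_in(1) P1 PP unfolding lune_at_def Aeq a'eq by (simp add: ips algebra_simps)
    show "0 \<le> (S * c1 + C * s1) * c2 + (T \<bullet> T') * ((S * s1 - C * c1) * s2)"
      using a'_in(1) P1 PP unfolding lune_at_def Aeq a'eq by (simp add: ips algebra_simps)
    show "0 \<le> (T \<bullet> T') * (c1 * (C * s2 + S * c2)) - s1 * (C * c2 - S * s2)"
      using a'_in(2) P1 PP unfolding lune_at_def Aeq a'eq by (simp add: ips algebra_simps)
    show "0 \<le> (S * c1 + C * s1) * (C * c2 - S * s2) + (T \<bullet> T') * ((S * s1 - C * c1) * (C * s2 + S * c2))"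
      using a'_in(2) P1 PP unfolding lune_at_def Aeq a'eq by (simp add: ips algebra_simps)
    show "0 \<le> (T \<bullet> T') * (c2 * s1) - s2 * c1"
      using A_in' P1 PP unfolding lune_at_def Aeq a'eq by (simp add: ips algebra_simps)
  qed
qed

text \<open>
  The chord at \<open>e\<close> contains a point of the great circle with normal \<open>e' \<times> g'\<close>, because it meets the chord at \<open>e'\<close>,
  and all its points are within distance \<open>D\<close> of \<open>e\<close>.  Here \<open>v\<close> is a multiple of that point.
\<close>

lemma touching_frame_extent:
  assumes C: "0 \<le> C" and CS: "0 < S" "C\<^sup>2 + S\<^sup>2 = 1"
    and fr: "touching_frame C S R e g" and fr': "touching_frame C S R e' g'"
  shows "(e \<bullet> (e' \<times> g'))\<^sup>2 \<le> S\<^sup>2"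
proof -
  define n where "n = e' \<times> g'"
  define f where "f = C *\<^sub>R e + S *\<^sub>R g"
  define al be where "al = e \<bullet> n" and "be = f \<bullet> n"
  have eg: "norm e = 1" "norm g = 1" "e \<bullet> g = 0" "norm e' = 1" "norm g' = 1" "e' \<bullet> g' = 0"
    using fr fr' by (auto simp: touching_frame_def)
  have ee: "e \<bullet> e = 1" "g \<bullet> g = 1" using eg by (simp_all add: dot_square_norm)
  have ef: "e \<bullet> f = C" "f \<bullet> f = 1" using ee eg CS
    by (simp_all add: f_def inner_add_left inner_add_right inner_commute power2_eq_square)
  have nn: "n \<bullet> n = 1" using norm_cross_orthonormal[OF eg(4-6)] by (simp add: n_def dot_square_norm)
  have cross: "al * be \<le> 0"
    using arcs_cross[OF C CS eg] fr fr' by (auto simp: touching_frame_def al_def be_def n_def f_def inner_commute)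
  define v where "v = be *\<^sub>R e - al *\<^sub>R f"
  have vv: "v \<bullet> v = be\<^sup>2 + al\<^sup>2 - 2 * (al * be) * C"
    unfolding v_def using ee ef by (simp add: inner_diff_left inner_diff_right inner_commute power2_eq_square algebra_simps)
  have ev: "e \<bullet> v = be - al * C"
    unfolding v_def using ee ef by (simp add: inner_diff_left inner_diff_right)
  have nv: "n \<bullet> v = 0" unfolding v_def al_def be_def by (simp add: inner_diff_right inner_commute)
  \<comment> \<open>As \<open>v\<close> is orthogonal to \<open>n\<close>, only the part of \<open>e\<close> orthogonal to \<open>n\<close> contributes to \<open>e \<bullet> v\<close>.\<close>
  have "((e - al *\<^sub>R n) \<bullet> v)\<^sup>2 \<le> ((e - al *\<^sub>R n) \<bullet> (e - al *\<^sub>R n)) * (v \<bullet> v)"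
    by (rule Cauchy_Schwarz_ineq)
  moreover have "(e - al *\<^sub>R n) \<bullet> v = be - al * C" using nv ev by (simp add: inner_diff_left)
  moreover have "(e - al *\<^sub>R n) \<bullet> (e - al *\<^sub>R n) = 1 - al\<^sup>2"
    using nn ee by (simp add: inner_diff_left inner_diff_right al_def[symmetric] inner_commute power2_eq_square)
  ultimately have "(be - al * C)\<^sup>2 \<le> (1 - al\<^sup>2) * (v \<bullet> v)" by simp
  then have "al\<^sup>2 * (v \<bullet> v) \<le> v \<bullet> v - (be - al * C)\<^sup>2" by (simp add: algebra_simps)
  also have "\<dots> = al\<^sup>2 * (1 - C\<^sup>2)" unfolding vv by (simp add: power2_eq_square algebra_simps)
  also have "1 - C\<^sup>2 = S\<^sup>2" using CS by linarith
  finally have "al\<^sup>2 * (v \<bullet> v) \<le> al\<^sup>2 * S\<^sup>2" .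
  moreover have "al\<^sup>2 \<le> v \<bullet> v"
  proof -
    have "(al * be) * C \<le> 0" using cross C by (simp add: mult_nonpos_nonneg)
    then have "2 * (al * be) * C \<le> 0" by linarith
    then show ?thesis unfolding vv using zero_le_power2[of be] by linarith
  qed
  ultimately have "al\<^sup>2 \<le> S\<^sup>2"
    by (smt (verit) mult_le_cancel_left_pos zero_le_power2)
  then show ?thesis by (simp add: al_def n_def)
qed

text \<open>
  In coordinates with respect to the frame of \<open>e\<close>, another contact point lies in the lune and within distance
  \<open>D\<close> of the great circle of the chord.  A point of the lune on this great circle has cosine at least \<open>C\<close> with \<open>e\<close>,
  and leaving the circle by at most \<open>D\<close> costs at most another factor \<open>C\<close>.
\<close>

lemma touching_frame_coordinates:
  assumes C: "0 \<le> C" and CS: "0 < S" "C\<^sup>2 + S\<^sup>2 = 1"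
    and fr: "touching_frame C S R e g" and fr': "touching_frame C S R e' g'"
  shows "(e' \<bullet> e)\<^sup>2 + (e' \<bullet> g)\<^sup>2 + (e' \<bullet> (e \<times> g))\<^sup>2 = 1"
    and "0 \<le> e' \<bullet> g" "C * (e' \<bullet> g) \<le> S * (e' \<bullet> e)" "(e' \<bullet> (e \<times> g))\<^sup>2 \<le> S\<^sup>2" "C\<^sup>2 \<le> e' \<bullet> e"
proof -
  show unit: "(e' \<bullet> e)\<^sup>2 + (e' \<bullet> g)\<^sup>2 + (e' \<bullet> (e \<times> g))\<^sup>2 = 1"
    using orthonormal_norm_square[of e g e'] fr fr' by (simp add: touching_frame_def dot_square_norm)
  show lune: "0 \<le> e' \<bullet> g" "C * (e' \<bullet> g) \<le> S * (e' \<bullet> e)"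
    using fr fr' by (auto simp: touching_frame_def lune_at_def)
  show ext: "(e' \<bullet> (e \<times> g))\<^sup>2 \<le> S\<^sup>2" by (rule touching_frame_extent[OF C CS fr' fr])
  have al0: "0 \<le> e' \<bullet> e" using lune C CS by (smt (verit) mult_nonneg_nonneg zero_le_mult_iff)
  show "C\<^sup>2 \<le> e' \<bullet> e"
  proof (rule power2_le_imp_le[OF _ al0])
    have "(C * (e' \<bullet> g))\<^sup>2 \<le> (S * (e' \<bullet> e))\<^sup>2" using lune C by (intro power_mono) auto
    then have "C\<^sup>2 * ((e' \<bullet> e)\<^sup>2 + (e' \<bullet> g)\<^sup>2) \<le> (C\<^sup>2 + S\<^sup>2) * (e' \<bullet> e)\<^sup>2"
      by (simp add: power_mult_distrib algebra_simps)
    then have 1: "C\<^sup>2 * ((e' \<bullet> e)\<^sup>2 + (e' \<bullet> g)\<^sup>2) \<le> (e' \<bullet> e)\<^sup>2" using CS by simp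
    have "C\<^sup>2 \<le> (e' \<bullet> e)\<^sup>2 + (e' \<bullet> g)\<^sup>2" using unit ext CS by linarith
    then have "C\<^sup>2 * C\<^sup>2 \<le> C\<^sup>2 * ((e' \<bullet> e)\<^sup>2 + (e' \<bullet> g)\<^sup>2)" by (intro mult_left_mono) auto
    then show "(C\<^sup>2)\<^sup>2 \<le> (e' \<bullet> e)\<^sup>2" using 1 by (simp add: power2_eq_square)
  qed
qed

section \<open>Triangles of contact points\<close>

text \<open>
  The coordinates are those of a contact point in the frame \<open>e\<close>, \<open>g\<close>, \<open>e \<times> g\<close> of another one.
  The vector \<open>(1, t, t)\<close> with \<open>t = (1 - C) / S = tan (D / 2)\<close> points to the circumcentre of the isosceles right
  triangle with legs \<open>D\<close> and right angle at \<open>e\<close>.  The claim is that the disk around it through \<open>e\<close>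
  contains one half of the lune, up to distance \<open>D\<close> from the great circle of the chord.  The estimate \<open>cos s + t * sin s \<ge> 1\<close> for
  \<open>0 \<le> s \<le> D\<close> is used twice: within the great circle of the chord, and then away from it.
\<close>

lemma half_square_covered:
  fixes C S al be ga :: real
  assumes C: "0 \<le> C" and CS: "0 < S" "C\<^sup>2 + S\<^sup>2 = 1"
    and unit: "al\<^sup>2 + be\<^sup>2 + ga\<^sup>2 = 1" and lune: "0 \<le> be" "C * be \<le> S * al" and ga: "0 \<le> ga" "ga\<^sup>2 \<le> S\<^sup>2"
  shows "1 \<le> al + (1 - C) / S * be + (1 - C) / S * ga"
proof -
  define t where "t = (1 - C) / S"
  have C1: "C < 1" using CS by (smt (verit) mult_le_cancel_left1 power2_eq_square zero_less_power2)
  have t0: "0 \<le> t" using C1 CS by (simp add: t_def)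
  have tS: "t * S = 1 - C" using CS by (simp add: t_def)
  have tC: "t * (1 + C) = S"
  proof -
    have "S * (t * (1 + C)) = (t * S) * (1 + C)" by (simp add: algebra_simps)
    also have "\<dots> = 1 - C\<^sup>2" unfolding tS by (simp add: power2_eq_square algebra_simps)
    also have "\<dots> = S * S" using CS by (simp add: power2_eq_square)
    finally have "S * (t * (1 + C)) = S * S" .
    then show ?thesis using CS by simp
  qed
  have al0: "0 \<le> al" using lune C CS by (smt (verit) mult_nonneg_nonneg zero_le_mult_iff)
  define m where "m = sqrt (al\<^sup>2 + be\<^sup>2)"
  have m0: "0 \<le> m" and m2: "m\<^sup>2 = 1 - ga\<^sup>2" using unit by (auto simp: m_def)
  have mC: "C \<le> m"
  proof (rule power2_le_imp_le[OF _ m0])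
    show "C\<^sup>2 \<le> m\<^sup>2" using m2 ga CS by linarith
  qed
  have "m \<le> al + t * be"
  proof (rule power2_le_imp_le)
    have "(1 + C) * ((al + t * be)\<^sup>2 - (al\<^sup>2 + be\<^sup>2)) = be * (2 * al * (t * (1 + C)) + be * (t * (t * (1 + C)) - 1 - C))"
      by (simp add: power2_eq_square algebra_simps)
    also have "\<dots> = 2 * (be * (S * al - C * be))" unfolding tC tS by (simp add: algebra_simps)
    finally have "0 \<le> (1 + C) * ((al + t * be)\<^sup>2 - (al\<^sup>2 + be\<^sup>2))" using lune by simp
    then have "0 \<le> (al + t * be)\<^sup>2 - (al\<^sup>2 + be\<^sup>2)" using C by (simp add: zero_le_mult_iff)
    then show "m\<^sup>2 \<le> (al + t * be)\<^sup>2" by (simp add: m_def)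
    show "0 \<le> al + t * be" using al0 t0 lune by simp
  qed
  moreover have "1 - m \<le> t * ga"
  proof (rule power2_le_imp_le)
    have "(1 + C) * ((t * ga)\<^sup>2 - (1 - m)\<^sup>2) = (t * (t * (1 + C))) * ga\<^sup>2 - (1 + C) * (1 - m)\<^sup>2"
      by (simp add: power2_eq_square algebra_simps)
    also have "\<dots> = (1 - C) * (1 - m\<^sup>2) - (1 + C) * (1 - m)\<^sup>2" unfolding tC tS using m2 by simp
    also have "\<dots> = 2 * (1 - m) * (m - C)" by (simp add: power2_eq_square algebra_simps)
    finally have "(1 + C) * ((t * ga)\<^sup>2 - (1 - m)\<^sup>2) = 2 * (1 - m) * (m - C)" .
    moreover have "m \<le> 1" using m2 by (metis diff_ge_0_iff_ge diff_diff_eq2 add_diff_cancel_left' abs_le_square_iff abs_one abs_of_nonneg m0 power_one zero_le_power2)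
    ultimately have "0 \<le> (1 + C) * ((t * ga)\<^sup>2 - (1 - m)\<^sup>2)" using mC by simp
    then show "(1 - m)\<^sup>2 \<le> (t * ga)\<^sup>2" using C by (simp add: zero_le_mult_iff)
    show "0 \<le> t * ga" using t0 ga by simp
  qed
  ultimately show ?thesis by (simp add: t_def)
qed

text \<open>
  The numbers \<open>a \<ge> c \<ge> b\<close> are half the squared side lengths of a planar triangle without obtuse angle, and \<open>radius\<close> says that
  its squared circumradius is \<open>2 * w / (2 + w)\<close>.  Writing \<open>k\<close> for the cosine of the largest angle and \<open>r\<close>
  for the ratio of the two smaller sides, scaling is eliminated by \<open>radius\<close>, the bound on \<open>a\<close>
  becomes \<open>w \<le> 2 * k\<close>, and the claim becomes a lower bound for an expression that decreases in \<open>w\<close>.  At \<open>w = 2 * k\<close>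
  it factors, and \<open>2 * k \<le> r \<le> 1\<close> makes both factors nonnegative.
  Equality holds for \<open>b = c = w\<close>, \<open>a = w * (2 - w)\<close>.
\<close>

lemma dominant_squared_sides:
  fixes a b c w :: real
  assumes b: "0 < b" "b \<le> c" "c \<le> a" and acute: "a \<le> b + c"
    and w: "0 < w" "w \<le> 1" and aw: "a \<le> w * (2 - w)"
    and radius: "w * (2 * (a*b + b*c + c*a) - (a\<^sup>2 + b\<^sup>2 + c\<^sup>2)) = a * b * c * (2 + w)"
  shows "w\<^sup>2 * (2 - b) \<le> a * c"
proof -
  have c: "0 < c" and a: "0 < a" using b by linarith+
  define k where "k = (b + c - a) / (2 * sqrt b * sqrt c)"
  define r where "r = sqrt b / sqrt c"
  define E where "E = 1 + r\<^sup>2 - 2 * k * r"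
  define j where "j = 1 - k\<^sup>2"
  have r0: "0 < r" and r1: "r \<le> 1" using b c by (auto simp: r_def)
  have b_r: "b = r\<^sup>2 * c" using b c by (simp add: r_def power_divide)
  have k0: "0 \<le> k" using acute b c by (simp add: k_def)
  have krc: "2 * k * r * c = b + c - a"
  proof -
    have "2 * k * r * c = (b + c - a) * (c / (sqrt c * sqrt c))"
    proof -
      have alg: "2 * (u / (2 * s * t)) * (s / t) * c = u * (c / (t * t))"
        if "s \<noteq> 0" "t \<noteq> 0" for s t u :: real
        using that by (simp add: field_simps)
      show ?thesis unfolding k_def r_def using b c by (intro alg) auto
    qed
    then show ?thesis using c by simp
  qed
  have a_E: "a = c * E" using krc b_r by (simp add: E_def algebra_simps)
  have kbc: "4 * b * c * k\<^sup>2 = (b + c - a)\<^sup>2"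
    using b c by (simp add: k_def power_divide power_mult_distrib)
  have heron: "2 * (a*b + b*c + c*a) - (a\<^sup>2 + b\<^sup>2 + c\<^sup>2) = 4 * b * c * j"
    using kbc unfolding j_def by (simp add: algebra_simps power2_eq_square)
  have aj: "a * (2 + w) = 4 * w * j"
  proof -
    have "(b * c) * (a * (2 + w)) = (b * c) * (4 * w * j)"
      using radius unfolding heron by (simp add: algebra_simps)
    then show ?thesis using b c by simp
  qed
  have E1: "1 \<le> E" using a_E b c by (metis mult_le_cancel_left1 not_less)
  have rk: "2 * k \<le> r"
  proof -
    have "r * (2 * k) \<le> r * r" using E1 by (simp add: E_def power2_eq_square algebra_simps)
    then show ?thesis using r0 by simp
  qed
  have k1: "k \<le> 1/2" using rk r1 by linarith
  have wk: "w \<le> 2 * k"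
  proof -
    have "a * (2 + w) \<le> w * (2 - w) * (2 + w)" using aw w by (intro mult_right_mono) auto
    then have "w * (4 * j) \<le> w * ((2 - w) * (2 + w))" unfolding aj by (simp add: algebra_simps)
    then have "4 * j \<le> (2 - w) * (2 + w)" using w by simp
    then have "w\<^sup>2 \<le> (2 * k)\<^sup>2" by (simp add: j_def power2_eq_square algebra_simps)
    then show ?thesis using k0 by (meson mult_nonneg_nonneg power2_le_imp_le zero_le_numeral)
  qed
  have j0: "0 < j" 
  proof -
    have "k\<^sup>2 \<le> (1/2)\<^sup>2" using k0 k1 by (intro power_mono)
    then show ?thesis by (simp add: j_def power2_eq_square)
  qed
  \<comment> \<open>The expression \<open>?F\<close> is monotone in \<open>v = 1 / (2 + w)\<close>, and \<open>v0\<close> belongs to the extreme value \<open>w = 2 * k\<close>.\<close>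
  define v where "v = 1 / (2 + w)"
  define v0 where "v0 = 1 / (2 + 2 * k)"
  have vv: "v0 \<le> v" using wk w k0 by (simp add: v_def v0_def frac_le)
  have jv0: "j * v0 = (1 - k) / 2"
  proof -
    have "j = (1 - k) * (1 + k)" by (simp add: j_def power2_eq_square algebra_simps)
    then show ?thesis using k0 by (simp add: v0_def field_simps)
  qed
  have kv0: "1 - 2 * v0 = 2 * k * v0" using k0 by (simp add: v0_def field_simps)
  let ?F = "\<lambda>v. 16 * j\<^sup>2 * v\<^sup>2 + 4 * r\<^sup>2 * j * (1 - 2 * v)"
  have F0: "2 * E \<le> ?F v0"
  proof -
    have "?F v0 = 16 * (j * v0)\<^sup>2 + 8 * r\<^sup>2 * k * (j * v0)"
      unfolding kv0 by (simp add: power2_eq_square algebra_simps)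
    also have "\<dots> = 4 * (1 - k)\<^sup>2 + 4 * r\<^sup>2 * k * (1 - k)"
      unfolding jv0 by (simp add: power2_eq_square field_simps)
    finally have F: "?F v0 = 4 * (1 - k)\<^sup>2 + 4 * r\<^sup>2 * k * (1 - k)" .
    have "?F v0 - 2 * E = 2 * ((1 - r) * ((1 - 2*k + 2*k\<^sup>2) * r + (1 - 4*k + 2*k\<^sup>2)))"
      unfolding F E_def by (simp add: power2_eq_square algebra_simps)
    moreover have "0 \<le> (1 - 2*k + 2*k\<^sup>2) * r + (1 - 4*k + 2*k\<^sup>2)"
    proof -
      have m: "0 \<le> 1 - 2*k + 2*k\<^sup>2" using k1 by (simp add: add_nonneg_nonneg)
      have "(1 - 2*k + 2*k\<^sup>2) * (2*k) \<le> (1 - 2*k + 2*k\<^sup>2) * r"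
        using rk m by (rule mult_left_mono)
      moreover have "(1 - 2*k + 2*k\<^sup>2) * (2*k) + (1 - 4*k + 2*k\<^sup>2) = (1 - 2*k) * (1 - 2*k\<^sup>2)"
        by (simp add: power2_eq_square algebra_simps)
      moreover have "0 \<le> (1 - 2*k) * (1 - 2*k\<^sup>2)"
      proof (rule mult_nonneg_nonneg)
        show "0 \<le> 1 - 2*k" using k1 by simp
        have "k\<^sup>2 \<le> (1/2)\<^sup>2" using k0 k1 by (intro power_mono)
        then show "0 \<le> 1 - 2*k\<^sup>2" by (simp add: power2_eq_square)
      qed
      ultimately show ?thesis by linarith
    qed
    ultimately show ?thesis using r1 by (smt (verit) mult_nonneg_nonneg)
  qed
  have Fmono: "?F v0 \<le> ?F v"
  proof -
    have "?F v - ?F v0 = (v - v0) * (8 * j) * (2 * j * v + 2 * j * v0 - r\<^sup>2)"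
      by (simp add: power2_eq_square algebra_simps)
    moreover have "r\<^sup>2 \<le> 2 * j * v + 2 * j * v0"
    proof -
      have "r\<^sup>2 \<le> 1" using r0 r1 by (simp add: power_le_one)
      moreover have "j * v0 \<le> j * v" using vv j0 by simp
      ultimately show ?thesis using jv0 k1 by (simp add: algebra_simps)
    qed
    ultimately show ?thesis using vv j0 by (smt (verit) mult_nonneg_nonneg)
  qed
  have av: "a = 4 * w * j * v" using aj w by (simp add: v_def field_simps)
  have wv: "w * v = 1 - 2 * v" using w by (simp add: v_def field_simps)
  have "w\<^sup>2 * (2 * E) \<le> w\<^sup>2 * ?F v" using F0 Fmono by (intro mult_left_mono) auto
  also have "\<dots> = a * a + w\<^sup>2 * r\<^sup>2 * a"
    unfolding av wv[symmetric] by (simp add: power2_eq_square algebra_simps)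
  finally have "w\<^sup>2 * (2 * E) - w\<^sup>2 * r\<^sup>2 * a \<le> a * a" by linarith
  then have "E * (w\<^sup>2 * (2 - b)) \<le> E * (a * c)"
    unfolding a_E b_r by (simp add: power2_eq_square algebra_simps)
  then show ?thesis using E1 by simp
qed

text \<open>
  A triangle that contains its circumcentre has no obtuse angle.
\<close>

lemma circumcentre_hull_acute:
  fixes e1 e2 e3 q :: "'a::real_inner"
  assumes lam: "0 \<le> l1" "0 \<le> l2" "0 \<le> l3" "l1 + l2 + l3 = 1"
    and q: "q = l1 *\<^sub>R e1 + l2 *\<^sub>R e2 + l3 *\<^sub>R e3"
    and eq: "norm (e1 - q) = s" "norm (e2 - q) = s" "norm (e3 - q) = s"
  shows "0 \<le> (e1 - e2) \<bullet> (e1 - e3)"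
proof -
  define z1 z2 z3 where "z1 = e1 - q" and "z2 = e2 - q" and "z3 = e3 - q"
  note z = z1_def z2_def z3_def
  have n: "z1 \<bullet> z1 = s\<^sup>2" "z2 \<bullet> z2 = s\<^sup>2" "z3 \<bullet> z3 = s\<^sup>2"
    using eq by (simp_all add: z dot_square_norm)
  have "l1 *\<^sub>R z1 + l2 *\<^sub>R z2 + l3 *\<^sub>R z3 = q - (l1 + l2 + l3) *\<^sub>R q"
    unfolding z q by (simp add: algebra_simps)
  then have sum0: "l1 *\<^sub>R z1 + l2 *\<^sub>R z2 + l3 *\<^sub>R z3 = 0" using lam by simp
  define M where "M = z2 + z3"
  have M23: "z2 \<bullet> M = M \<bullet> M / 2" "z3 \<bullet> M = M \<bullet> M / 2"
    using n by (simp_all add: M_def inner_add_left inner_add_right inner_commute)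
  have "(l1 *\<^sub>R z1 + l2 *\<^sub>R z2 + l3 *\<^sub>R z3) \<bullet> M = 0" using sum0 by simp
  then have rel: "l1 * (z1 \<bullet> M) + (l2 + l3) * (M \<bullet> M / 2) = 0"
    by (simp add: inner_add_left M23 algebra_simps add_divide_distrib)
  have "2 * ((e1 - e2) \<bullet> (e1 - e3)) = M \<bullet> M - 2 * (z1 \<bullet> M)"
  proof -
    have "(e1 - e2) \<bullet> (e1 - e3) = (z1 - z2) \<bullet> (z1 - z3)" by (simp add: z)
    then show ?thesis using n
      by (simp add: M_def inner_add_left inner_add_right inner_diff_left inner_diff_right inner_commute)
  qed
  moreover have "2 * (z1 \<bullet> M) \<le> M \<bullet> M"
  proof (cases "l1 = 0")
    case True
    then have "M \<bullet> M = 0" using rel lam by simp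
    then show ?thesis by simp
  next
    case False
    have "l1 * (z1 \<bullet> M) \<le> 0" using rel lam by (smt (verit) inner_ge_zero mult_nonneg_nonneg zero_le_divide_iff)
    then have "z1 \<bullet> M \<le> 0" using False lam by (simp add: mult_le_0_iff)
    then show ?thesis by (smt (verit) inner_ge_zero)
  qed
  ultimately show ?thesis by linarith
qed

text \<open>
  The hypothesis \<open>altitude\<close> bounds the distance of \<open>e2\<close> from the great circle through \<open>e1\<close> and \<open>e3\<close>, the
  shortest side.  If \<open>q\<close> were too short, then the parameter \<open>w\<close> belonging to the circumradius by
  \<open>dominant_squared_sides\<close> would exceed \<open>1 - C\<close>.  The side bound then holds for \<open>w\<close> with room to spare, and
  the conclusion of \<open>dominant_squared_sides\<close> makes the altitude too large.
\<close>

lemma acute_triangle_altitude: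
  fixes e1 e2 e3 q :: "'a::real_inner"
  assumes u: "norm e1 = 1" "norm e2 = 1" "norm e3 = 1"
    and lam: "0 \<le> l1" "0 \<le> l2" "0 \<le> l3" "l1 + l2 + l3 = 1"
    and q: "q = l1 *\<^sub>R e1 + l2 *\<^sub>R e2 + l3 *\<^sub>R e3"
    and qe: "q \<bullet> e1 = q \<bullet> q" "q \<bullet> e2 = q \<bullet> q" "q \<bullet> e3 = q \<bullet> q"
    and order: "e2 \<bullet> e3 \<le> e1 \<bullet> e2" "e1 \<bullet> e2 \<le> e1 \<bullet> e3" "e1 \<bullet> e3 < 1"
    and C: "0 \<le> C" "C < 1" and side: "C\<^sup>2 \<le> e2 \<bullet> e3"
    and altitude: "C\<^sup>2 * (1 - (e1 \<bullet> e3)\<^sup>2) \<le> 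
       (e2 \<bullet> e3)\<^sup>2 + (e1 \<bullet> e2)\<^sup>2 - 2 * (e2 \<bullet> e3) * (e1 \<bullet> e3) * (e1 \<bullet> e2)"
  shows "(1 + C) / (3 - C) \<le> q \<bullet> q"
proof (rule ccontr)
  assume "\<not> ?thesis"
  then have small: "q \<bullet> q < (1 + C) / (3 - C)" by simp
  define x y z K where "x = e2 \<bullet> e3" and "y = e1 \<bullet> e3" and "z = e1 \<bullet> e2" and "K = q \<bullet> q"
  define a b c where "a = 1 - x" and "b = 1 - y" and "c = 1 - z"
  define N where "N = 2 * (a*b + b*c + c*a) - (a\<^sup>2 + b\<^sup>2 + c\<^sup>2)"
  have un: "e1 \<bullet> e1 = 1" "e2 \<bullet> e2 = 1" "e3 \<bullet> e3 = 1" using u by (simp_all add: dot_square_norm)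
  have x0: "0 \<le> x" using side by (smt (verit) x_def zero_le_power2)
  have xyz: "x \<le> z" "z \<le> y" "y < 1" using order by (auto simp: x_def y_def z_def)
  have abc: "0 < b" "b \<le> c" "c \<le> a" using xyz by (auto simp: a_def b_def c_def)
  have eqs: "l1 + z * l2 + y * l3 = K" "z * l1 + l2 + x * l3 = K" "y * l1 + x * l2 + l3 = K"
  proof -
    have "q \<bullet> e1 = K" "q \<bullet> e2 = K" "q \<bullet> e3 = K" using qe by (simp_all add: K_def)
    then show "l1 + z * l2 + y * l3 = K" "z * l1 + l2 + x * l3 = K" "y * l1 + x * l2 + l3 = K"
      unfolding q by (simp_all add: inner_add_left un x_def y_def z_def inner_commute algebra_simps)
  qed
  have det: "1 + 2*x*y*z - x\<^sup>2 - y\<^sup>2 - z\<^sup>2 = K * N"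
  proof -
    \<comment> \<open>The row sums of the adjugate of the Gram matrix solve the linear system \<open>eqs\<close> by Cramer's rule.\<close>
    define r1 r2 r3 where "r1 = (1 - x\<^sup>2) + (x*y - z) + (x*z - y)"
      and "r2 = (1 - y\<^sup>2) + (x*y - z) + (y*z - x)" and "r3 = (1 - z\<^sup>2) + (x*z - y) + (y*z - x)"
    note r = r1_def r2_def r3_def
    have "(1 + 2*x*y*z - x\<^sup>2 - y\<^sup>2 - z\<^sup>2) * (l1 + l2 + l3)
      = r1 * (l1 + z * l2 + y * l3) + r2 * (z * l1 + l2 + x * l3) + r3 * (y * l1 + x * l2 + l3)"
      unfolding r by (simp add: power2_eq_square algebra_simps)
    also have "\<dots> = K * (r1 + r2 + r3)" unfolding eqs by (simp add: algebra_simps)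
    also have "r1 + r2 + r3 = N" unfolding r N_def a_def b_def c_def
      by (simp add: power2_eq_square algebra_simps)
    finally show ?thesis using lam by simp
  qed
  have detN: "1 + 2*x*y*z - x\<^sup>2 - y\<^sup>2 - z\<^sup>2 = N - 2 * a * b * c"
    unfolding N_def a_def b_def c_def by (simp add: power2_eq_square algebra_simps)
  have dist: "norm (e1 - q) = sqrt (1 - K)" "norm (e2 - q) = sqrt (1 - K)" "norm (e3 - q) = sqrt (1 - K)"
    using qe un unfolding K_def norm_eq_sqrt_inner
    by (simp_all add: inner_diff_left inner_diff_right inner_commute)
  have acute: "a \<le> b + c"
    using circumcentre_hull_acute[OF lam q dist]
    by (simp add: inner_diff_left inner_diff_right un a_def b_def c_def x_def y_def z_def inner_commute)
  have Kl: "K = l1\<^sup>2 + l2\<^sup>2 + l3\<^sup>2 + 2 * (z * (l1 * l2) + y * (l1 * l3) + x * (l2 * l3))"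
    unfolding K_def q using un
    by (simp add: inner_add_left inner_add_right x_def y_def z_def inner_commute power2_eq_square algebra_simps)
  have K13: "1/3 \<le> K"
  proof -
    have "1/3 \<le> l1\<^sup>2 + l2\<^sup>2 + l3\<^sup>2"
    proof -
      have "0 \<le> (l1 - 1/3)\<^sup>2 + (l2 - 1/3)\<^sup>2 + (l3 - 1/3)\<^sup>2" by simp
      then show ?thesis using lam by (simp add: power2_eq_square algebra_simps)
    qed
    moreover have "0 \<le> z * (l1 * l2) + y * (l1 * l3) + x * (l2 * l3)"
      using x0 xyz lam by (intro add_nonneg_nonneg mult_nonneg_nonneg) auto
    ultimately show ?thesis unfolding Kl by argo
  qed
  \<comment> \<open>This solves \<open>1 - K = 2 * w / (2 + w)\<close>, where \<open>1 - K\<close> is the squared circumradius.\<close>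
  define w where "w = 2 * (1 - K) / (1 + K)"
  have w1: "w \<le> 1" using K13 by (simp add: w_def field_simps)
  have wC: "1 - C < w"
  proof -
    have "K * (3 - C) < 1 + C" using small C by (simp add: K_def pos_less_divide_eq)
    then show ?thesis using K13 by (simp add: w_def field_simps)
  qed
  have w0: "0 < w" using wC C by simp
  have Kw: "K * (2 + w) = 2 - w" using K13 by (simp add: w_def field_simps)
  have Nw: "w * N = a * b * c * (2 + w)"
  proof -
    have e: "K * N = N - 2 * a * b * c" using det detN by simp
    have "(2 - w) * N = (2 + w) * (K * N)" unfolding Kw[symmetric] by (simp add: algebra_simps)
    then have "(2 - w) * N = (2 + w) * (N - 2 * a * b * c)" using e by simp
    then show ?thesis by (simp add: algebra_simps)
  qed
  have Cw: "1 - C\<^sup>2 < w * (2 - w)"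
  proof -
    have "w * (2 - w) - (1 - C\<^sup>2) = (w - (1 - C)) * (1 + C - w)"
      by (simp add: power2_eq_square algebra_simps)
    moreover have "0 < (w - (1 - C)) * (1 + C - w)" using wC w1 by (intro mult_pos_pos) auto
    ultimately show ?thesis by linarith
  qed
  have aw: "a \<le> w * (2 - w)" using side Cw by (simp add: a_def x_def)
  have key: "w\<^sup>2 * (2 - b) \<le> a * c"
    using dominant_squared_sides[OF abc acute w0 w1 aw] Nw unfolding N_def by simp
  have "N - 2 * a * b * c \<le> (1 - C\<^sup>2) * (1 - y\<^sup>2)"
    unfolding detN[symmetric] using altitude
    by (simp add: x_def[symmetric] y_def[symmetric] z_def[symmetric] algebra_simps)
  also have "\<dots> = (1 - C\<^sup>2) * (b * (2 - b))" by (simp add: b_def power2_eq_square algebra_simps)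
  also have "\<dots> < w * (2 - w) * (b * (2 - b))"
  proof (rule mult_strict_right_mono[OF Cw])
    have "b \<le> 1" using x0 xyz by (simp add: b_def)
    then show "0 < b * (2 - b)" using abc by simp
  qed
  finally have "w * (N - 2 * a * b * c) < w * (w * (2 - w) * (b * (2 - b)))"
    using w0 by simp
  moreover have "w * (N - 2 * a * b * c) = (b * (2 - w)) * (a * c)"
    using Nw by (simp add: algebra_simps)
  ultimately have "(b * (2 - w)) * (a * c) < (b * (2 - w)) * (w\<^sup>2 * (2 - b))"
    by (simp add: power2_eq_square algebra_simps)
  then have "a * c < w\<^sup>2 * (2 - b)" using abc w1 by simp
  then show False using key by simp
qed

text \<open>
  The two cases are those of \<open>e1\<close> and \<open>e3\<close> on the same side, or on different sides, of the chord at \<open>e2\<close>.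
\<close>

lemma contact_triangle_ordered:
  fixes e1 e2 e3 q :: "real^3"
  assumes C: "0 \<le> C" and CS: "0 < S" "C\<^sup>2 + S\<^sup>2 = 1"
    and fr: "touching_frame C S R e1 g1" "touching_frame C S R e2 g2" "touching_frame C S R e3 g3"
    and lam: "0 \<le> l1" "0 \<le> l2" "0 \<le> l3" "l1 + l2 + l3 = 1"
    and q: "q = l1 *\<^sub>R e1 + l2 *\<^sub>R e2 + l3 *\<^sub>R e3"
    and qe: "q \<bullet> e1 = q \<bullet> q" "q \<bullet> e2 = q \<bullet> q" "q \<bullet> e3 = q \<bullet> q"
    and order: "e2 \<bullet> e3 \<le> e1 \<bullet> e2" "e1 \<bullet> e2 \<le> e1 \<bullet> e3"
  shows "(1 + C) / (3 - C) \<le> q \<bullet> q"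
proof -
  define n where "n = e2 \<times> g2"
  have C1: "C < 1" using CS by (smt (verit) mult_le_cancel_left1 power2_eq_square zero_less_power2)
  have u: "norm e1 = 1" "norm e2 = 1" "norm e3 = 1" "norm g2 = 1" "e2 \<bullet> g2 = 0"
    using fr by (auto simp: touching_frame_def)
  have uu: "e1 \<bullet> e1 = 1" "e2 \<bullet> e2 = 1" "e3 \<bullet> e3 = 1" "g2 \<bullet> g2 = 1" "n \<bullet> n = 1"
    using u norm_cross_orthonormal[OF u(2,4,5)] by (simp_all add: dot_square_norm n_def)
  have n: "e2 \<bullet> n = 0" "g2 \<bullet> n = 0" by (simp_all add: n_def dot_cross_self)
  note co1 = touching_frame_coordinates[OF C CS fr(2,1), folded n_def]
  note co3 = touching_frame_coordinates[OF C CS fr(2,3), folded n_def]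
  show ?thesis
  proof (cases "0 \<le> (e1 \<bullet> n) * (e3 \<bullet> n)")
    case True
    then obtain s :: real where s: "s\<^sup>2 = 1" "0 \<le> s * (e1 \<bullet> n)" "0 \<le> s * (e3 \<bullet> n)"
    proof -
      have "(0 \<le> e1 \<bullet> n \<and> 0 \<le> e3 \<bullet> n) \<or> (e1 \<bullet> n \<le> 0 \<and> e3 \<bullet> n \<le> 0)"
        using True by (simp add: zero_le_mult_iff)
      then show thesis using that[of 1] that[of "-1"] by auto
    qed
    define t where "t = (1 - C) / S"
    define c where "c = e2 + t *\<^sub>R g2 + (s * t) *\<^sub>R n"
    have s2: "s * s = 1" using s by (simp add: power2_eq_square)
    have c_dot: "c \<bullet> x = x \<bullet> e2 + t * (x \<bullet> g2) + t * (s * (x \<bullet> n))" for x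
      by (simp add: c_def inner_add_left inner_commute algebra_simps)
    have cover: "1 \<le> c \<bullet> e1" "1 \<le> c \<bullet> e3"
    proof -
      show "1 \<le> c \<bullet> e1" unfolding c_dot t_def
        using co1 s(1,2) by (intro half_square_covered[OF C CS]) (auto simp: power_mult_distrib)
      show "1 \<le> c \<bullet> e3" unfolding c_dot t_def
        using co3 s(1,3) by (intro half_square_covered[OF C CS]) (auto simp: power_mult_distrib)
    qed
    have ce2: "c \<bullet> e2 = 1" unfolding c_dot using uu u n by simp
    have "1 = l1 * 1 + l2 * 1 + l3 * 1" using lam by simp
    also have "\<dots> \<le> l1 * (c \<bullet> e1) + l2 * (c \<bullet> e2) + l3 * (c \<bullet> e3)"
      using cover ce2 lam by (intro add_mono mult_left_mono) auto
    also have "\<dots> = c \<bullet> q" by (simp add: q inner_add_right)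
    finally have "1 \<le> (c \<bullet> q)\<^sup>2" by (simp add: one_le_power)
    also have "\<dots> \<le> (c \<bullet> c) * (q \<bullet> q)" by (rule Cauchy_Schwarz_ineq)
    also have "c \<bullet> c = 1 + 2 * t\<^sup>2"
      unfolding c_def using uu u n s2
      by (simp add: inner_add_left inner_add_right inner_commute power2_eq_square algebra_simps)
    also have "1 + 2 * t\<^sup>2 = (3 - C) / (1 + C)"
    proof -
      have "S\<^sup>2 = (1 - C) * (1 + C)" using CS by (simp add: power2_eq_square algebra_simps)
      then have "t\<^sup>2 = (1 - C) / (1 + C)" using C C1 by (simp add: t_def power_divide power2_eq_square)
      then show ?thesis using C by (simp add: field_simps)
    qed
    finally show ?thesis using C C1 by (simp add: field_simps)
  next
    case False
    then have opp: "(e1 \<bullet> n) * (e3 \<bullet> n) < 0" by simp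
    \<comment> \<open>The chord at \<open>e2\<close> crosses the side from \<open>e1\<close> to \<open>e3\<close> in the direction \<open>p\<close>, which is at distance at
      most \<open>D\<close> from \<open>e2\<close>.\<close>
    then obtain s t :: real where st: "0 < s" "0 < t" "s * (e1 \<bullet> n) + t * (e3 \<bullet> n) = 0"
    proof -
      consider "0 < e1 \<bullet> n" "e3 \<bullet> n < 0" | "e1 \<bullet> n < 0" "0 < e3 \<bullet> n" using opp by (auto simp: mult_less_0_iff)
      then show thesis
        by cases (use that[of "- (e3 \<bullet> n)" "e1 \<bullet> n"] that[of "e3 \<bullet> n" "- (e1 \<bullet> n)"] in auto)
    qed
    have "e1 \<noteq> e3" using opp by (auto simp: mult_less_0_iff)
    then have e13: "e1 \<bullet> e3 < 1"
      using uu inner_ge_zero[of "e1 - e3"] inner_eq_zero_iff[of "e1 - e3"]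
      by (smt (verit) eq_iff_diff_eq_0 inner_commute inner_diff_left inner_diff_right)
    define x y z where "x = e2 \<bullet> e3" and "y = e1 \<bullet> e3" and "z = e1 \<bullet> e2"
    have x: "C\<^sup>2 \<le> x" using co3 by (simp add: x_def inner_commute)
    have x0: "0 \<le> x" using x by (smt (verit) zero_le_power2)
    define p where "p = s *\<^sub>R e1 + t *\<^sub>R e3"
    have pn: "p \<bullet> n = 0" using st by (simp add: p_def inner_add_left)
    have pe: "p \<bullet> e2 = s * z + t * x" by (simp add: p_def x_def z_def inner_add_left inner_add_right inner_commute)
    have pp: "p \<bullet> p = s\<^sup>2 + t\<^sup>2 + 2 * s * t * y"
      using uu by (simp add: p_def y_def inner_add_left inner_add_right inner_commute power2_eq_square algebra_simps)
    have pg: "0 \<le> p \<bullet> g2" "C * (p \<bullet> g2) \<le> S * (p \<bullet> e2)"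
    proof -
      show "0 \<le> p \<bullet> g2" using co1 co3 st by (simp add: p_def inner_add_left)
      have "s * (C * (e1 \<bullet> g2)) + t * (C * (e3 \<bullet> g2)) \<le> s * (S * (e1 \<bullet> e2)) + t * (S * (e3 \<bullet> e2))"
        using co1 co3 st by (intro add_mono mult_left_mono) auto
      then show "C * (p \<bullet> g2) \<le> S * (p \<bullet> e2)" by (simp add: p_def inner_add_left algebra_simps)
    qed
    have near: "C\<^sup>2 * (p \<bullet> p) \<le> (p \<bullet> e2)\<^sup>2"
    proof -
      have "(C * (p \<bullet> g2))\<^sup>2 \<le> (S * (p \<bullet> e2))\<^sup>2" using pg C by (intro power_mono) auto
      then have "C\<^sup>2 * ((p \<bullet> e2)\<^sup>2 + (p \<bullet> g2)\<^sup>2) \<le> (C\<^sup>2 + S\<^sup>2) * (p \<bullet> e2)\<^sup>2"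
        by (simp add: power_mult_distrib algebra_simps)
      moreover have "p \<bullet> p = (p \<bullet> e2)\<^sup>2 + (p \<bullet> g2)\<^sup>2"
        using orthonormal_norm_square[OF u(2,4,5), of p] pn by (simp add: n_def)
      ultimately show ?thesis using CS by simp
    qed
    have pp0: "0 < p \<bullet> p"
    proof -
      have "0 \<le> y" using x0 order by (simp add: x_def y_def)
      then have "0 \<le> 2 * s * t * y" using st by simp
      moreover have "0 < s\<^sup>2" "0 < t\<^sup>2" using st by simp_all
      ultimately show ?thesis unfolding pp by linarith
    qed
    have "C\<^sup>2 * (1 - y\<^sup>2) \<le> x\<^sup>2 + z\<^sup>2 - 2 * x * y * z"
    proof -
      have y1: "0 \<le> 1 - y\<^sup>2"
        using Cauchy_Schwarz_ineq[of e1 e3] uu by (simp add: y_def)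
      have "(p \<bullet> p) * (C\<^sup>2 * (1 - y\<^sup>2)) = (C\<^sup>2 * (p \<bullet> p)) * (1 - y\<^sup>2)" by simp
      also have "\<dots> \<le> (p \<bullet> e2)\<^sup>2 * (1 - y\<^sup>2)" using near y1 by (rule mult_right_mono)
      \<comment> \<open>Cauchy-Schwarz within the plane of \<open>e1\<close> and \<open>e3\<close>: the defect is a square.\<close>
      also have "\<dots> = (p \<bullet> p) * (x\<^sup>2 + z\<^sup>2 - 2 * x * y * z) - (s * (x - y * z) - t * (z - x * y))\<^sup>2"
        unfolding pe pp by (simp add: power2_eq_square algebra_simps)
      also have "\<dots> \<le> (p \<bullet> p) * (x\<^sup>2 + z\<^sup>2 - 2 * x * y * z)" by simp
      finally show ?thesis using pp0 by simp
    qed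
    then show ?thesis
      using acute_triangle_altitude[OF u(1-3) lam q qe order e13 C C1] x by (simp add: x_def y_def z_def)
  qed
qed

lemma contact_triangle:
  fixes e1 e2 e3 q :: "real^3"
  assumes C: "0 \<le> C" and CS: "0 < S" "C\<^sup>2 + S\<^sup>2 = 1"
    and fr: "touching_frame C S R e1 g1" "touching_frame C S R e2 g2" "touching_frame C S R e3 g3"
    and lam: "0 \<le> l1" "0 \<le> l2" "0 \<le> l3" "l1 + l2 + l3 = 1"
    and q: "q = l1 *\<^sub>R e1 + l2 *\<^sub>R e2 + l3 *\<^sub>R e3"
    and qe: "q \<bullet> e1 = q \<bullet> q" "q \<bullet> e2 = q \<bullet> q" "q \<bullet> e3 = q \<bullet> q"
  shows "(1 + C) / (3 - C) \<le> q \<bullet> q"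
proof -
  have lam': "l1 + l3 + l2 = 1" "l2 + l1 + l3 = 1" "l2 + l3 + l1 = 1" "l3 + l1 + l2 = 1" "l3 + l2 + l1 = 1"
    using lam by linarith+
  have q': "q = l1 *\<^sub>R e1 + l3 *\<^sub>R e3 + l2 *\<^sub>R e2" "q = l2 *\<^sub>R e2 + l1 *\<^sub>R e1 + l3 *\<^sub>R e3"
    "q = l2 *\<^sub>R e2 + l3 *\<^sub>R e3 + l1 *\<^sub>R e1" "q = l3 *\<^sub>R e3 + l1 *\<^sub>R e1 + l2 *\<^sub>R e2"
    "q = l3 *\<^sub>R e3 + l2 *\<^sub>R e2 + l1 *\<^sub>R e1" using q by (simp_all add: algebra_simps)
  note rule = contact_triangle_ordered[OF C CS]
  note perms = rule[OF fr(1,2,3) lam(1,2,3) lam(4) q qe(1,2,3)]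
    rule[OF fr(1,3,2) lam(1,3,2) lam'(1) q'(1) qe(1,3,2)]
    rule[OF fr(2,1,3) lam(2,1,3) lam'(2) q'(2) qe(2,1,3)]
    rule[OF fr(2,3,1) lam(2,3,1) lam'(3) q'(3) qe(2,3,1)]
    rule[OF fr(3,1,2) lam(3,1,2) lam'(4) q'(4) qe(3,1,2)]
    rule[OF fr(3,2,1) lam(3,2,1) lam'(5) q'(5) qe(3,2,1)]
  have "e2 \<bullet> e1 = e1 \<bullet> e2" "e3 \<bullet> e1 = e1 \<bullet> e3" "e3 \<bullet> e2 = e2 \<bullet> e3" by (simp_all add: inner_commute)
  note perms = perms[unfolded this]
  show ?thesis using perms by linarith
qed

section \<open>The covering disk\<close>

text \<open>
  This expresses the radius of the covering disk by \<open>cos d\<close> alone, since \<open>(tan (d / 2))\<^sup>2 = (1 - cos d) / (1 + cos d)\<close>.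
\<close>

lemma cos_arctan_circumradius:
  assumes "0 \<le> d" "d \<le> pi / 2"
  shows "(cos (arctan (sqrt 2 * tan (d / 2))))\<^sup>2 = (1 + cos d) / (3 - cos d)"
proof -
  have c0: "0 \<le> cos d" using assms by (intro cos_ge_zero) auto
  have t: "tan (d / 2) = sin d / (cos d + 1)" using tan_half[of "d / 2"] by simp
  have "(tan (d / 2))\<^sup>2 = (1 - (cos d)\<^sup>2) / (cos d + 1)\<^sup>2"
    unfolding t power_divide sin_squared_eq ..
  also have "\<dots> = (1 - cos d) / (1 + cos d)"
  proof -
    have nz: "(cos d + 1)\<^sup>2 \<noteq> 0" "1 + cos d \<noteq> 0" using c0 by auto
    show ?thesis by (subst frac_eq_eq[OF nz]) (simp add: power2_eq_square algebra_simps)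
  qed
  finally have t2: "(tan (d / 2))\<^sup>2 = (1 - cos d) / (1 + cos d)" .
  have "(cos (arctan (sqrt 2 * tan (d / 2))))\<^sup>2 = 1 / (1 + 2 * (tan (d / 2))\<^sup>2)"
    by (simp add: cos_arctan power_divide power_mult_distrib)
  also have "\<dots> = (1 + cos d) / (3 - cos d)"
  proof -
    have "1 + 2 * (tan (d / 2))\<^sup>2 = (3 - cos d) / (1 + cos d)" unfolding t2 using c0 by (simp add: field_simps)
    then show ?thesis by simp
  qed
  finally show ?thesis .
qed

lemma card_le_3_enum:
  assumes "finite F" "F \<noteq> {}" "card F \<le> 3"
  obtains a b c where "F = {a, b, c}"
proof -
  obtain a where a: "a \<in> F" using assms by blast
  have ca: "card (F - {a}) \<le> 2" using assms a by simp
  show thesis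
  proof (cases "F - {a} = {}")
    case True
    then have "F = {a, a, a}" using a by blast
    then show ?thesis by (rule that)
  next
    case False
    then obtain b where b: "b \<in> F - {a}" by blast
    then have "card (F - {a} - {b}) \<le> 1" using ca assms by simp
    then have "F - {a} - {b} = {} \<or> (\<exists>c. F - {a} - {b} = {c})"
      using assms by (metis card_0_eq card_1_singletonE finite_Diff le_less less_one)
    then show ?thesis
    proof
      assume "F - {a} - {b} = {}"
      then have "F = {a, b, b}" using a b by blast
      then show ?thesis by (rule that)
    next
      assume "\<exists>c. F - {a} - {b} = {c}"
      then obtain c where "F - {a} - {b} = {c}" ..
      then have "F = {a, b, c}" using a b by blast
      then show ?thesis by (rule that)
    qed
  qed
qed

text \<open>
  The point of the hull closest to the origin lies in the face cut out by its supporting hyperplane.  This face is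
  spanned by points of \<open>R\<close> and has dimension at most two, whence three points suffice.
\<close>

lemma contact_triangle_exists:
  fixes R :: "(real^3) set"
  assumes R: "compact R" and q: "q \<in> convex hull R" and min: "\<And>x. x \<in> R \<Longrightarrow> q \<bullet> q \<le> q \<bullet> x" and q0: "q \<noteq> 0"
  obtains e1 e2 e3 l1 l2 l3 where "{e1, e2, e3} \<subseteq> {x \<in> R. q \<bullet> x = q \<bullet> q}"
    "0 \<le> l1" "0 \<le> l2" "0 \<le> l3" "l1 + l2 + l3 = 1" "q = l1 *\<^sub>R e1 + l2 *\<^sub>R e2 + l3 *\<^sub>R e3"
proof -
  let ?H = "{x. q \<bullet> x = q \<bullet> q}"
  have minh: "q \<bullet> q \<le> q \<bullet> x" if "x \<in> convex hull R" for x
  proof -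
    have "convex hull R \<subseteq> {x. q \<bullet> q \<le> q \<bullet> x}"
      using min by (intro hull_minimal) (auto simp: convex_halfspace_ge)
    then show ?thesis using that by blast
  qed
  have face: "(convex hull R \<inter> ?H) face_of (convex hull R)"
    by (rule face_of_Int_supporting_hyperplane_ge[OF convex_convex_hull minh])
  obtain A where A: "A \<subseteq> R" "convex hull R \<inter> ?H = convex hull A"
    by (rule face_of_convex_hull_subset[OF R face])
  have AH: "A \<subseteq> ?H" using A(2) hull_subset[of A convex] by blast
  have "aff_dim A \<le> aff_dim ?H" using AH by (rule aff_dim_subset)
  also have "\<dots> = 2" using q0 by (simp add: aff_dim_hyperplane)
  finally have dim: "aff_dim A \<le> 2" .
  have "q \<in> convex hull A" using q A(2) by blast
  then obtain F where F: "finite F" "F \<subseteq> A" "card F \<le> aff_dim A + 1" "q \<in> convex hull F"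
    unfolding caratheodory_aff_dim[of A] by blast
  have "F \<noteq> {}" using F(4) by auto
  moreover have "card F \<le> 3" using F(3) dim by linarith
  ultimately obtain a b c where abc: "F = {a, b, c}" using card_le_3_enum F(1) by metis
  have "{a, b, c} \<subseteq> {x \<in> R. q \<bullet> x = q \<bullet> q}" using abc F(2) A(1) AH by blast
  moreover obtain u v w where "0 \<le> u" "0 \<le> v" "0 \<le> w" "u + v + w = 1" "q = u *\<^sub>R a + v *\<^sub>R b + w *\<^sub>R c"
    using F(4) unfolding abc convex_hull_3 by blast
  ultimately show thesis by (rule that)
qed

theorem theorem5p2:
  fixes R :: "(real^3) set"
  assumes "reduced_body R"
    and "thickness R \<le> pi / 2"
  shows "\<exists>c\<in>S2. R \<subseteq> sdisk c (arctan (sqrt 2 * tan (thickness R / 2)))"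
proof -
  let ?d = "thickness R"
  have body: "sconvex_body R" using assms by (simp add: reduced_body_def)
  then have cv: "sconvex R" by (simp add: sconvex_body_def)
  obtain g0 h0 :: "real^3" where gh0: "\<bar>g0 \<bullet> h0\<bar> < 1" "thickness R = arccos (- (g0 \<bullet> h0))"
    using thickness_normals[OF body] by blast
  have d0: "0 < ?d"
  proof -
    have "arccos 1 < arccos (- (g0 \<bullet> h0))" using gh0(1) by (intro arccos_less_arccos) auto
    then show ?thesis using gh0 by simp
  qed
  define C S where "C = cos ?d" and "S = sin ?d"
  have C0: "0 \<le> C" using d0 assms(2) by (auto simp: C_def intro!: cos_ge_zero)
  have S0: "0 < S" using d0 assms(2) pi_gt_zero by (auto simp: S_def intro!: sin_gt_zero)
  have CS: "C\<^sup>2 + S\<^sup>2 = 1" by (simp add: C_def S_def)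
  have C1: "C \<le> 1" by (simp add: C_def)
  define X where "X = convex hull R"
  have X: "convex X" "closed X" "X \<noteq> {}" "0 \<notin> X"
    using sconvex_body_compact[OF body] sconvex_body_nonempty[OF body] sgn_hull[OF cv]
    by (auto simp: X_def compact_convex_hull compact_imp_closed)
  define q where "q = closest_point X 0"
  have qX: "q \<in> X" unfolding q_def using X by (intro closest_point_in_set)
  have q0: "q \<noteq> 0" using qX X by auto
  have qq: "0 < q \<bullet> q" using q0 by simp
  have n1: "norm x = 1" if "x \<in> R" for x by (rule sconvex_body_norm[OF body that])
  have min: "q \<bullet> q \<le> q \<bullet> x" if "x \<in> R" for x
  proof -
    have "x \<in> X" using that by (simp add: X_def hull_inc)
    then have "(0 - q) \<bullet> (x - q) \<le> 0" unfolding q_def using X by (intro closest_point_dot) auto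
    then show ?thesis by (simp add: inner_diff_right)
  qed
  have big: "(1 + C) / (3 - C) \<le> q \<bullet> q"
  proof (rule ccontr)
    assume "\<not> ?thesis"
    moreover have "(1 + C) / (3 - C) \<le> 1" using C1 by simp
    ultimately have small: "q \<bullet> q < 1" by linarith
    \<comment> \<open>A contact point is exposed by the component of \<open>q\<close> tangent to the sphere there; this component vanishes
      only when the disk shrinks to a point, which \<open>small\<close> excludes.\<close>
    have frame: "\<exists>g. touching_frame C S R e g" if e: "e \<in> {x \<in> R. q \<bullet> x = q \<bullet> q}" for e
      unfolding C_def S_def
    proof (rule contact_touching_frame[OF assms(1), where k = "q \<bullet> q" and v = "q - (q \<bullet> q) *\<^sub>R e"])
      have ee: "e \<bullet> e = 1" using e n1 by (simp add: dot_square_norm)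
      show "e \<in> R" using e by simp
      show "(q - (q \<bullet> q) *\<^sub>R e) \<bullet> e = 0" using e ee by (simp add: inner_diff_left)
      show "0 < q \<bullet> q" by (rule qq)
      show "q \<bullet> q * (1 - x \<bullet> e) \<le> (q - (q \<bullet> q) *\<^sub>R e) \<bullet> x" if "x \<in> R" for x
        using min[OF that] by (simp add: inner_diff_left inner_commute algebra_simps)
      show "q - (q \<bullet> q) *\<^sub>R e \<noteq> 0"
      proof
        assume "q - (q \<bullet> q) *\<^sub>R e = 0"
        then have "q = (q \<bullet> q) *\<^sub>R e" by simp
        then have "q \<bullet> q = (q \<bullet> q) * (q \<bullet> q)" by (metis ee inner_scaleR_left inner_scaleR_right mult.right_neutral)
        then show False using qq small by simp
      qed
    qed
    obtain e1 e2 e3 l1 l2 l3 where contact: "{e1, e2, e3} \<subseteq> {x \<in> R. q \<bullet> x = q \<bullet> q}"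
      and l: "0 \<le> l1" "0 \<le> l2" "0 \<le> l3" "l1 + l2 + l3 = 1" and q: "q = l1 *\<^sub>R e1 + l2 *\<^sub>R e2 + l3 *\<^sub>R e3"
      by (rule contact_triangle_exists[OF sconvex_body_compact[OF body] qX[unfolded X_def] min q0])
    obtain g1 where "touching_frame C S R e1 g1" using frame[of e1] contact by auto
    moreover obtain g2 where "touching_frame C S R e2 g2" using frame[of e2] contact by auto
    moreover obtain g3 where "touching_frame C S R e3 g3" using frame[of e3] contact by auto
    ultimately have "(1 + C) / (3 - C) \<le> q \<bullet> q"
      by (rule contact_triangle[OF C0 S0 CS _ _ _ l q]) (use contact in auto)
    then show False using \<open>\<not> (1 + C) / (3 - C) \<le> q \<bullet> q\<close> by simp
  qed
  let ?rho = "arctan (sqrt 2 * tan (?d / 2))"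
  have rho: "0 \<le> ?rho" "?rho \<le> pi"
  proof -
    have "0 \<le> tan (?d / 2)" using d0 assms(2) by (intro less_imp_le tan_gt_zero) auto
    then show "0 \<le> ?rho" by simp
    show "?rho \<le> pi" using arctan_ubound[of "sqrt 2 * tan (?d / 2)"] pi_gt_zero by linarith
  qed
  have cos_rho: "cos ?rho \<le> norm q"
  proof (rule power2_le_imp_le)
    show "(cos ?rho)\<^sup>2 \<le> (norm q)\<^sup>2"
      using big cos_arctan_circumradius[of ?d] d0 assms(2) by (simp add: C_def power2_norm_eq_inner)
  qed simp
  have "sgn q \<in> S2" using q0 by (simp add: mem_S2 norm_sgn)
  moreover have "R \<subseteq> sdisk (sgn q) ?rho"
  proof
    fix x assume x: "x \<in> R"
    have "norm q * norm q \<le> q \<bullet> x" using min[OF x] by (simp add: dot_square_norm power2_eq_square)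
    then have "norm q \<le> sgn q \<bullet> x" using q0 by (simp add: sgn_div_norm field_simps)
    then have le: "cos ?rho \<le> sgn q \<bullet> x" using cos_rho by linarith
    have "\<bar>sgn q \<bullet> x\<bar> \<le> 1" using q0 n1[OF x] by (intro abs_inner_le_1) (auto simp: norm_sgn)
    then have "arccos (sgn q \<bullet> x) \<le> arccos (cos ?rho)" using le by (subst arccos_le_mono) auto
    also have "\<dots> = ?rho" using rho by (rule arccos_cos)
    finally show "x \<in> sdisk (sgn q) ?rho" using n1[OF x] by (simp add: sdisk_def sdist_def mem_S2)
  qed
  ultimately show ?thesis by blast
qed

end
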